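(* Let $E\to M$ be a Courant algebroid, $V_+\subset E$ a generalized metric, $\operatorname{div}$ a divergence on $E$, $\tau:M'\to M$ a smooth map, and let $\tau^*E\to M'$ be a CA-pullback of $E$. Then $\mathrm{GRic}^{\tau^*E}_{\tau^*V_+,\tau^*\operatorname{div}}=\tau^*\mathrm{GRic}^E_{V_+,\operatorname{div}}$, i.e. $$\mathrm{GRic}^{\tau^*E}_{\tau^*V_+,\tau^*\operatorname{div}}(\tau^*a_+,\tau^*b_-)=\tau^*\bigl(\mathrm{GRic}^E_{V_+,\operatorname{div}}(a_+,b_-)\bigr)\qquad\forall a_+\in\Gamma(V_+),\ b_-\in\Gamma(V_-).$$
   Context: A Courant algebroid (CA) is a vector bundle $E\to M$ with a non-degenerate symmetric fibrewise bilinear form $\langle\,,\,\rangle$, a bundle map $\rho:E\to TM$ (the anchor) and an $\mathbb R$-bilinear bracket $[\,,\,]:\Gamma(E)\times\Gamma(E)\to\Gamma(E)$ such that for $u,v,w\in\Gamma(E)$, $f\in C^\infty(M)$: $[u,[v,w]]=[[u,v],w]+[v,[u,w]]$; $[u,fv]=f[u,v]+(u\cdot f)v$; $u\cdot\langle v,w\rangle=\langle[u,v],w\rangle+\langle v,[u,w]\rangle$; $[u,v]+[v,u]=d_E\langle u,v\rangle$. Here $u\cdot f:=\rho(u)f$ and $d_Ef\in\Gamma(E)$ is defined by $\langle u,d_Ef\rangle=u\cdot f$. A generalized pseudometric is a subbundle $V_+\subset E$ on which $\langle\,,\,\rangle$ is non-degenerate; $V_-:=V_+^\perp$. It is a generalized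 metric if $\langle\,,\,\rangle$ is positive-definite on $V_+$ and negative-definite on $V_-$. Subscripts $\pm$ denote orthogonal projections to $V_\pm$. A divergence on $E$ is an $\mathbb R$-linear map $\operatorname{div}:\Gamma(E)\to C^\infty(M)$ with $\operatorname{div}(fa)=f\operatorname{div}a+a\cdot f$. Generalized Ricci tensor: for $a_+\in\Gamma(V_+)$, $b_-\in\Gamma(V_-)$, $$\mathrm{GRic}^E_{V_+,\operatorname{div}}(a_+,b_-):=\operatorname{div}[b_-,a_+]_+-b_-\cdot\operatorname{div}a_+-\operatorname{Tr}_{V_+}[[\,\cdot\,,b_-]_-,a_+]_+ .$$ CA-pullback: for a smooth map $\tau:M'\to M$, the vector bundle $\tau^*E\to M'$ is called a CA-pullback of $E$ if it is equipped with a CA structure $(\langle\,,\,\rangle',[\,,\,]',\rho')$ with $\langle\tau^*u,\tau^*v\rangle'=\tau^*\langle u,v\rangle$, $[\tau^*u,\tau^*v]'=\tau^*[u,v]$, $\tau_*(\rho'(\tau^*u))=\rho(u)$ for all $u,v\in\Gamma(E)$. Then $\tau^*V_+\subset\tau^*E$ is a generalized metric, and $\tau^*\operatorname{div}$ is the unique divergence on $\tau^*E$ with $(\tau^*\operatorname{div})(\tau^*u)=\tau^*(\operatorname{div}u)$ for all $u\in\Gamma(E)$. *)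

theory Defs
  imports "HOL-Analysis.Analysis"
begin

text \<open>
  Conventions.  A manifold lives on a whole type (Hausdorff, second countable); its dimension
  is a natural number, with \<open>0\<close> allowed, and its charts take values in the library's
  \<^const>\<open>Euclidean_space\<close> \<open>n\<close>, i.e. in the functions \<open>nat \<Rightarrow> real\<close> vanishing from index
  \<open>n\<close> on.  The fibres of a vector bundle are linear subspaces of one real vector space, of
  possibly infinite dimension, which serves as a container only: every bundle has this shape up
  to isomorphism, the direct sum of its fibres being a possible container.
\<close>

subsection \<open>Smooth manifolds\<close>

primrec Ck_on :: "nat \<Rightarrow> nat \<Rightarrow> (nat \<Rightarrow> real) set \<Rightarrow> ((nat \<Rightarrow> real) \<Rightarrow> real) \<Rightarrow> bool" where
  "Ck_on n 0 S f \<longleftrightarrow>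
     continuous_map (subtopology (Euclidean_space n) S) euclideanreal f"
| "Ck_on n (Suc k) S f \<longleftrightarrow>
     continuous_map (subtopology (Euclidean_space n) S) euclideanreal f \<and>
     (\<forall>i<n. \<exists>g. (\<forall>x\<in>S. ((\<lambda>t. f (x(i := t))) has_real_derivative g x) (at (x i))) \<and>
                Ck_on n k S g)"

text \<open>Smoothness on \<open>S\<close>, meant for \<open>S\<close> open in \<^const>\<open>Euclidean_space\<close> \<open>n\<close>.\<close>

definition Cinf_on :: "nat \<Rightarrow> (nat \<Rightarrow> real) set \<Rightarrow> ((nat \<Rightarrow> real) \<Rightarrow> real) \<Rightarrow> bool" where
  "Cinf_on n S f \<longleftrightarrow> (\<forall>k. Ck_on n k S f)"

record 'm manifold =
  mdim :: nat
  charts :: "('m set \<times> ('m \<Rightarrow> nat \<Rightarrow> real)) set"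

definition smooth_manifold ::
    "'m::{t2_space, second_countable_topology} manifold \<Rightarrow> bool" where
  "smooth_manifold M \<longleftrightarrow>
     (\<Union>(U, \<phi>)\<in>charts M. U) = UNIV \<and>
     (\<forall>(U, \<phi>)\<in>charts M.
        open U \<and> openin (Euclidean_space (mdim M)) (\<phi> ` U) \<and>
        homeomorphic_map (top_of_set U) (subtopology (Euclidean_space (mdim M)) (\<phi> ` U)) \<phi>) \<and>
     (\<forall>(U, \<phi>)\<in>charts M. \<forall>(V, \<psi>)\<in>charts M. \<forall>i<mdim M.
        Cinf_on (mdim M) (\<phi> ` (U \<inter> V)) (\<lambda>y. \<psi> (inv_into U \<phi> y) i))"

text \<open>Smoothness of a function on an open subset \<open>W\<close> of \<open>M\<close>.\<close>

definition smooth_on :: "'m manifold \<Rightarrow> 'm set \<Rightarrow> ('m \<Rightarrow> real) \<Rightarrow> bool" where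
  "smooth_on M W f \<longleftrightarrow>
     (\<forall>(U, \<phi>)\<in>charts M. Cinf_on (mdim M) (\<phi> ` (U \<inter> W)) (\<lambda>y. f (inv_into U \<phi> y)))"

definition smooth_functions :: "'m manifold \<Rightarrow> ('m \<Rightarrow> real) set" where
  "smooth_functions M = {f. smooth_on M UNIV f}"

definition smooth_map ::
    "'n::topological_space manifold \<Rightarrow> 'm::topological_space manifold \<Rightarrow> ('n \<Rightarrow> 'm) \<Rightarrow> bool" where
  "smooth_map M' M \<tau> \<longleftrightarrow>
     continuous_on UNIV \<tau> \<and>
     (\<forall>(V, \<psi>)\<in>charts M. \<forall>i<mdim M. smooth_on M' (\<tau> -` V) (\<lambda>x. \<psi> (\<tau> x) i))"

text \<open>
  The tangent space at \<open>x\<close> consists of the derivations at \<open>x\<close> of the algebra of smooth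
  functions.  Derivations are extended by \<open>0\<close> to all functions, so that equality of tangent
  vectors is equality in HOL.
\<close>

definition tangent_space :: "'m manifold \<Rightarrow> 'm \<Rightarrow> (('m \<Rightarrow> real) \<Rightarrow> real) set" where
  "tangent_space M x = {D.
     (\<forall>f. f \<notin> smooth_functions M \<longrightarrow> D f = 0) \<and>
     (\<forall>f\<in>smooth_functions M. \<forall>g\<in>smooth_functions M. D (\<lambda>y. f y + g y) = D f + D g) \<and>
     (\<forall>c. \<forall>f\<in>smooth_functions M. D (\<lambda>y. c * f y) = c * D f) \<and>
     (\<forall>f\<in>smooth_functions M. \<forall>g\<in>smooth_functions M.
        D (\<lambda>y. f y * g y) = f x * D g + g x * D f)}"

definition pushforward ::
    "'m manifold \<Rightarrow> ('n \<Rightarrow> 'm) \<Rightarrow> (('n \<Rightarrow> real) \<Rightarrow> real) \<Rightarrow> ('m \<Rightarrow> real) \<Rightarrow> real" where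
  "pushforward M \<tau> D = (\<lambda>f. if f \<in> smooth_functions M then D (f \<circ> \<tau>) else 0)"

subsection \<open>Vector bundles\<close>

text \<open>
  The bundle structure is given by an atlas of local frames \<open>(U, k, e)\<close>: for \<open>x \<in> U\<close> the vectors
  \<open>e 0 x, \<dots>, e (k - 1) x\<close> are a basis of the fibre at \<open>x\<close>.  Such a frame is the same as the
  local trivialization sending \<open>(x, c)\<close> to the linear combination of the \<open>e i x\<close> with
  coefficients \<open>c i\<close>.
\<close>

record ('m, 'v) vbundle =
  fibre :: "'m \<Rightarrow> 'v set"
  frames :: "('m set \<times> nat \<times> (nat \<Rightarrow> 'm \<Rightarrow> 'v)) set"

definition smooth_section_on ::
    "'m manifold \<Rightarrow> ('m, 'v::real_vector) vbundle \<Rightarrow> 'm set \<Rightarrow> ('m \<Rightarrow> 'v) \<Rightarrow> bool" where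
  "smooth_section_on M E W s \<longleftrightarrow>
     (\<forall>(U, k, e)\<in>frames E. \<exists>c.
        (\<forall>i<k. smooth_on M (U \<inter> W) (c i)) \<and>
        (\<forall>x\<in>U \<inter> W. s x = (\<Sum>i<k. c i x *\<^sub>R e i x)))"

definition basis_of :: "'v::real_vector set \<Rightarrow> nat \<Rightarrow> (nat \<Rightarrow> 'v) \<Rightarrow> bool" where
  "basis_of W k b \<longleftrightarrow>
     inj_on b {..<k} \<and> independent (b ` {..<k}) \<and> span (b ` {..<k}) = W"

definition vector_bundle ::
    "'m::topological_space manifold \<Rightarrow> ('m, 'v::real_vector) vbundle \<Rightarrow> bool" where
  "vector_bundle M E \<longleftrightarrow>
     (\<Union>(U, k, e)\<in>frames E. U) = UNIV \<and>
     (\<forall>(U, k, e)\<in>frames E.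
        open U \<and>
        (\<forall>x\<in>U. basis_of (fibre E x) k (\<lambda>i. e i x)) \<and>
        (\<forall>j<k. smooth_section_on M E U (e j)))"

definition sections :: "'m manifold \<Rightarrow> ('m, 'v::real_vector) vbundle \<Rightarrow> ('m \<Rightarrow> 'v) set" where
  "sections M E = {s. (\<forall>x. s x \<in> fibre E x) \<and> smooth_section_on M E UNIV s}"

definition pullback_bundle ::
    "('n \<Rightarrow> 'm) \<Rightarrow> ('m, 'v) vbundle \<Rightarrow> ('n, 'v) vbundle" where
  "pullback_bundle \<tau> E =
     \<lparr>fibre = (\<lambda>x. fibre E (\<tau> x)),
      frames = (\<lambda>(U, k, e). (\<tau> -` U, k, \<lambda>i. e i \<circ> \<tau>)) ` frames E\<rparr>"

definition subbundle ::
    "'m::topological_space manifold \<Rightarrow> ('m, 'v::real_vector) vbundle \<Rightarrow> ('m \<Rightarrow> 'v set) \<Rightarrow> bool" where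
  "subbundle M E V \<longleftrightarrow>
     (\<forall>x. subspace (V x) \<and> V x \<subseteq> fibre E x) \<and>
     (\<forall>x. \<exists>U k b. open U \<and> x \<in> U \<and>
        (\<forall>j<k. smooth_section_on M E U (b j)) \<and>
        (\<forall>y\<in>U. basis_of (V y) k (\<lambda>j. b j y)))"

definition sub_sections ::
    "'m manifold \<Rightarrow> ('m, 'v::real_vector) vbundle \<Rightarrow> ('m \<Rightarrow> 'v set) \<Rightarrow> ('m \<Rightarrow> 'v) set" where
  "sub_sections M E V = {s \<in> sections M E. \<forall>x. s x \<in> V x}"

subsection \<open>Courant algebroids\<close>

record ('m, 'v) ca_structure =
  pairing :: "'m \<Rightarrow> 'v \<Rightarrow> 'v \<Rightarrow> real"
  anchor :: "'m \<Rightarrow> 'v \<Rightarrow> ('m \<Rightarrow> real) \<Rightarrow> real"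
  bracket :: "('m \<Rightarrow> 'v) \<Rightarrow> ('m \<Rightarrow> 'v) \<Rightarrow> ('m \<Rightarrow> 'v)"

definition fibre_metric ::
    "'m manifold \<Rightarrow> ('m, 'v::real_vector) vbundle \<Rightarrow> ('m \<Rightarrow> 'v \<Rightarrow> 'v \<Rightarrow> real) \<Rightarrow> bool" where
  "fibre_metric M E g \<longleftrightarrow>
     (\<forall>x. \<forall>u\<in>fibre E x. \<forall>v\<in>fibre E x. g x u v = g x v u) \<and>
     (\<forall>x. \<forall>u\<in>fibre E x. \<forall>v\<in>fibre E x. \<forall>w\<in>fibre E x. g x (u + v) w = g x u w + g x v w) \<and>
     (\<forall>x c. \<forall>u\<in>fibre E x. \<forall>v\<in>fibre E x. g x (c *\<^sub>R u) v = c * g x u v) \<and>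
     (\<forall>x. \<forall>u\<in>fibre E x. (\<forall>v\<in>fibre E x. g x u v = 0) \<longrightarrow> u = 0) \<and>
     (\<forall>(U, k, e)\<in>frames E. \<forall>i<k. \<forall>j<k. smooth_on M U (\<lambda>x. g x (e i x) (e j x)))"

text \<open>
  A bundle map to the tangent bundle: smoothness means that frame sections are mapped to smooth
  vector fields, i.e. to fields that differentiate smooth functions to smooth functions.
\<close>

definition anchor_map ::
    "'m manifold \<Rightarrow> ('m, 'v::real_vector) vbundle \<Rightarrow> ('m \<Rightarrow> 'v \<Rightarrow> ('m \<Rightarrow> real) \<Rightarrow> real) \<Rightarrow> bool" where
  "anchor_map M E \<rho> \<longleftrightarrow>
     (\<forall>x. \<forall>u\<in>fibre E x. \<rho> x u \<in> tangent_space M x) \<and>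
     (\<forall>x. \<forall>u\<in>fibre E x. \<forall>v\<in>fibre E x. \<forall>f. \<rho> x (u + v) f = \<rho> x u f + \<rho> x v f) \<and>
     (\<forall>x c. \<forall>u\<in>fibre E x. \<forall>f. \<rho> x (c *\<^sub>R u) f = c * \<rho> x u f) \<and>
     (\<forall>(U, k, e)\<in>frames E. \<forall>i<k. \<forall>f\<in>smooth_functions M. smooth_on M U (\<lambda>x. \<rho> x (e i x) f))"

definition act :: "('m, 'v) ca_structure \<Rightarrow> ('m \<Rightarrow> 'v) \<Rightarrow> ('m \<Rightarrow> real) \<Rightarrow> 'm \<Rightarrow> real" where
  "act A u f = (\<lambda>x. anchor A x (u x) f)"

definition pair :: "('m, 'v) ca_structure \<Rightarrow> ('m \<Rightarrow> 'v) \<Rightarrow> ('m \<Rightarrow> 'v) \<Rightarrow> 'm \<Rightarrow> real" where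
  "pair A u v = (\<lambda>x. pairing A x (u x) (v x))"

definition d_E ::
    "('m, 'v) vbundle \<Rightarrow> ('m, 'v) ca_structure \<Rightarrow> ('m \<Rightarrow> real) \<Rightarrow> 'm \<Rightarrow> 'v" where
  "d_E E A f = (\<lambda>x. THE w. w \<in> fibre E x \<and> (\<forall>u\<in>fibre E x. pairing A x u w = anchor A x u f))"

definition courant_algebroid ::
    "'m::topological_space manifold \<Rightarrow> ('m, 'v::real_vector) vbundle \<Rightarrow>
     ('m, 'v) ca_structure \<Rightarrow> bool" where
  "courant_algebroid M E A \<longleftrightarrow>
     vector_bundle M E \<and> fibre_metric M E (pairing A) \<and> anchor_map M E (anchor A) \<and>
     (\<forall>u\<in>sections M E. \<forall>v\<in>sections M E. bracket A u v \<in> sections M E) \<and>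
     (\<forall>u\<in>sections M E. \<forall>v\<in>sections M E. \<forall>w\<in>sections M E.
        bracket A (\<lambda>x. u x + v x) w = (\<lambda>x. bracket A u w x + bracket A v w x) \<and>
        bracket A w (\<lambda>x. u x + v x) = (\<lambda>x. bracket A w u x + bracket A w v x)) \<and>
     (\<forall>c. \<forall>u\<in>sections M E. \<forall>v\<in>sections M E.
        bracket A (\<lambda>x. c *\<^sub>R u x) v = (\<lambda>x. c *\<^sub>R bracket A u v x) \<and>
        bracket A u (\<lambda>x. c *\<^sub>R v x) = (\<lambda>x. c *\<^sub>R bracket A u v x)) \<and>
     (\<forall>u\<in>sections M E. \<forall>v\<in>sections M E. \<forall>w\<in>sections M E.
        bracket A u (bracket A v w) =
          (\<lambda>x. bracket A (bracket A u v) w x + bracket A v (bracket A u w) x)) \<and>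
     (\<forall>u\<in>sections M E. \<forall>v\<in>sections M E. \<forall>f\<in>smooth_functions M.
        bracket A u (\<lambda>x. f x *\<^sub>R v x) = (\<lambda>x. f x *\<^sub>R bracket A u v x + act A u f x *\<^sub>R v x)) \<and>
     (\<forall>u\<in>sections M E. \<forall>v\<in>sections M E. \<forall>w\<in>sections M E.
        act A u (pair A v w) =
          (\<lambda>x. pair A (bracket A u v) w x + pair A v (bracket A u w) x)) \<and>
     (\<forall>u\<in>sections M E. \<forall>v\<in>sections M E.
        (\<lambda>x. bracket A u v x + bracket A v u x) = d_E E A (pair A u v))"

subsection \<open>Generalized metrics, divergences and the generalized Ricci tensor\<close>

definition perp ::
    "('m, 'v) vbundle \<Rightarrow> ('m, 'v) ca_structure \<Rightarrow> ('m \<Rightarrow> 'v set) \<Rightarrow> 'm \<Rightarrow> 'v set" where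
  "perp E A V = (\<lambda>x. {w \<in> fibre E x. \<forall>v\<in>V x. pairing A x v w = 0})"

definition generalized_pseudometric ::
    "'m::topological_space manifold \<Rightarrow> ('m, 'v::real_vector) vbundle \<Rightarrow>
     ('m, 'v) ca_structure \<Rightarrow> ('m \<Rightarrow> 'v set) \<Rightarrow> bool" where
  "generalized_pseudometric M E A V \<longleftrightarrow>
     subbundle M E V \<and> (\<forall>x. \<forall>u\<in>V x. (\<forall>v\<in>V x. pairing A x u v = 0) \<longrightarrow> u = 0)"

definition generalized_metric ::
    "'m::topological_space manifold \<Rightarrow> ('m, 'v::real_vector) vbundle \<Rightarrow>
     ('m, 'v) ca_structure \<Rightarrow> ('m \<Rightarrow> 'v set) \<Rightarrow> bool" where
  "generalized_metric M E A V \<longleftrightarrow>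
     generalized_pseudometric M E A V \<and>
     (\<forall>x. \<forall>u\<in>V x. u \<noteq> 0 \<longrightarrow> pairing A x u u > 0) \<and>
     (\<forall>x. \<forall>u\<in>perp E A V x. u \<noteq> 0 \<longrightarrow> pairing A x u u < 0)"

text \<open>Orthogonal projection of a section \<open>w\<close> to \<open>V\<close>.\<close>

definition oproj ::
    "('m, 'v::real_vector) vbundle \<Rightarrow> ('m, 'v) ca_structure \<Rightarrow> ('m \<Rightarrow> 'v set) \<Rightarrow>
     ('m \<Rightarrow> 'v) \<Rightarrow> 'm \<Rightarrow> 'v" where
  "oproj E A V w = (\<lambda>x. THE v. v \<in> V x \<and> w x - v \<in> perp E A V x)"

definition divergence ::
    "'m manifold \<Rightarrow> ('m, 'v::real_vector) vbundle \<Rightarrow> ('m, 'v) ca_structure \<Rightarrow>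
     (('m \<Rightarrow> 'v) \<Rightarrow> 'm \<Rightarrow> real) \<Rightarrow> bool" where
  "divergence M E A dv \<longleftrightarrow>
     (\<forall>u\<in>sections M E. dv u \<in> smooth_functions M) \<and>
     (\<forall>u\<in>sections M E. \<forall>v\<in>sections M E. dv (\<lambda>x. u x + v x) = (\<lambda>x. dv u x + dv v x)) \<and>
     (\<forall>c. \<forall>u\<in>sections M E. dv (\<lambda>x. c *\<^sub>R u x) = (\<lambda>x. c * dv u x)) \<and>
     (\<forall>f\<in>smooth_functions M. \<forall>u\<in>sections M E.
        dv (\<lambda>x. f x *\<^sub>R u x) = (\<lambda>x. f x * dv u x + act A u f x))"

text \<open>Trace of a linear endomorphism \<open>F\<close> of a finite-dimensional subspace \<open>W\<close>, in any basis.\<close>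

definition trace_on :: "'v::real_vector set \<Rightarrow> ('v \<Rightarrow> 'v) \<Rightarrow> real" where
  "trace_on W F =
     (let B = (SOME B. independent B \<and> span B = W) in \<Sum>b\<in>B. representation B (F b) b)"

text \<open>
  The endomorphism of the fibre \<open>V x\<close> induced by an operator \<open>T\<close> on sections of \<open>V\<close> that is
  linear over the smooth functions: the value of \<open>T u\<close> at \<open>x\<close> then depends only on \<open>u x\<close>, so
  the choice of the section \<open>u\<close> through \<open>v\<close> is immaterial.
\<close>

definition fibre_endo ::
    "'m manifold \<Rightarrow> ('m, 'v::real_vector) vbundle \<Rightarrow> ('m \<Rightarrow> 'v set) \<Rightarrow>
     (('m \<Rightarrow> 'v) \<Rightarrow> 'm \<Rightarrow> 'v) \<Rightarrow> 'm \<Rightarrow> 'v \<Rightarrow> 'v" where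
  "fibre_endo M E V T x v = T (SOME u. u \<in> sub_sections M E V \<and> u x = v) x"

definition bundle_trace ::
    "'m manifold \<Rightarrow> ('m, 'v::real_vector) vbundle \<Rightarrow> ('m \<Rightarrow> 'v set) \<Rightarrow>
     (('m \<Rightarrow> 'v) \<Rightarrow> 'm \<Rightarrow> 'v) \<Rightarrow> 'm \<Rightarrow> real" where
  "bundle_trace M E V T = (\<lambda>x. trace_on (V x) (fibre_endo M E V T x))"

definition GRic ::
    "'m manifold \<Rightarrow> ('m, 'v::real_vector) vbundle \<Rightarrow> ('m, 'v) ca_structure \<Rightarrow>
     ('m \<Rightarrow> 'v set) \<Rightarrow> (('m \<Rightarrow> 'v) \<Rightarrow> 'm \<Rightarrow> real) \<Rightarrow> ('m \<Rightarrow> 'v) \<Rightarrow> ('m \<Rightarrow> 'v) \<Rightarrow> 'm \<Rightarrow> real" where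
  "GRic M E A V dv a b = (\<lambda>x.
     dv (oproj E A V (bracket A b a)) x
     - act A b (dv a) x
     - bundle_trace M E V
         (\<lambda>u. oproj E A V (bracket A (oproj E A (perp E A V) (bracket A u b)) a)) x)"

subsection \<open>Pullbacks\<close>

text \<open>
  The fibre of the pullback bundle at \<open>x\<close> is literally the fibre at \<open>\<tau> x\<close>, so pullbacks of
  sections, functions and subbundles are all given by composition with \<open>\<tau>\<close>.  The pullback of a
  divergence is determined on all smooth sections by the property below, since pullback sections
  locally generate the sections of the pullback bundle.
\<close>

definition ca_pullback ::
    "'n::topological_space manifold \<Rightarrow> 'm manifold \<Rightarrow> ('n \<Rightarrow> 'm) \<Rightarrow>
     ('m, 'v::real_vector) vbundle \<Rightarrow> ('m, 'v) ca_structure \<Rightarrow> ('n, 'v) ca_structure \<Rightarrow> bool" where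
  "ca_pullback M' M \<tau> E A A' \<longleftrightarrow>
     courant_algebroid M' (pullback_bundle \<tau> E) A' \<and>
     (\<forall>u\<in>sections M E. \<forall>v\<in>sections M E.
        pair A' (u \<circ> \<tau>) (v \<circ> \<tau>) = pair A u v \<circ> \<tau> \<and>
        bracket A' (u \<circ> \<tau>) (v \<circ> \<tau>) = bracket A u v \<circ> \<tau>) \<and>
     (\<forall>u\<in>sections M E. \<forall>x.
        pushforward M \<tau> (anchor A' x (u (\<tau> x))) = anchor A (\<tau> x) (u (\<tau> x)))"

definition is_pullback_divergence ::
    "'n manifold \<Rightarrow> 'm manifold \<Rightarrow> ('n \<Rightarrow> 'm) \<Rightarrow> ('m, 'v::real_vector) vbundle \<Rightarrow>
     ('n, 'v) ca_structure \<Rightarrow> (('m \<Rightarrow> 'v) \<Rightarrow> 'm \<Rightarrow> real) \<Rightarrow> (('n \<Rightarrow> 'v) \<Rightarrow> 'n \<Rightarrow> real) \<Rightarrow> bool" where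
  "is_pullback_divergence M' M \<tau> E A' dv dv' \<longleftrightarrow>
     divergence M' (pullback_bundle \<tau> E) A' dv' \<and>
     (\<forall>u\<in>sections M E. dv' (u \<circ> \<tau>) = dv u \<circ> \<tau>)"

end

theory Submission
  imports Defs
begin

text \<open>
  Every ingredient of the generalized Ricci tensor is compatible with pullback.  Brackets of
  pulled-back sections, their divergences and the derivatives of pulled-back functions are so by
  assumption.  The pairing is compatible fibre by fibre, because each vector of a fibre is the
  value of a global section (\<open>section_through\<close>); hence orthogonal complements and projections
  are compatible too (\<open>perp_pullback\<close>, \<open>oproj_pullback\<close>).

  Two points need an argument.  First, these compatibilities speak of smooth sections only, so that
  the orthogonal projection of a smooth section has to be smooth
  (\<open>orthogonal_projection_section\<close>): Gram--Schmidt applies to local frames since the pairing is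
  positive on \<open>V\<close>.  Secondly, the trace on the pullback involves sections of the pulled-back
  subbundle that are not pulled back from the base.  They can be replaced by pulled-back ones
  because the operator \<open>u \<mapsto> [[u, b]\<^sub>-, a]\<^sub>+\<close> is tensorial: its value at a point depends only
  on the value of \<open>u\<close> there (\<open>ricci_operator_tensorial\<close>).  Indeed, replacing \<open>u\<close> by \<open>f u\<close>
  creates one derivative of \<open>f\<close> in each bracket; the first multiplies \<open>u\<close>, the second a section
  orthogonal to \<open>V\<close>, and the projection that follows kills each of them
  (\<open>ricci_operator_scale\<close>).  Linearity over the smooth functions gives dependence on the value
  alone because a section vanishing at \<open>x\<close> is a combination of sections with smooth coefficients
  vanishing at \<open>x\<close> (\<open>vanishing_section_decomposition\<close>).

  The rest is analysis: bump functions on Hausdorff manifolds, and the chain rule for smooth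
  functions of several variables, without which neither the extension of a function out of a chart
  nor the pullback of a section would be smooth.
\<close>

section \<open>Smooth functions on Euclidean domains\<close>

lemma subtopology_Euclidean_space:
  assumes "S \<subseteq> topspace (Euclidean_space n)"
  shows "subtopology (Euclidean_space n) S = top_of_set S"
  using assms
  by (auto simp: topspace_Euclidean_space Euclidean_space_def euclidean_product_topology
      subtopology_subtopology intro: arg_cong[where f = top_of_set])

lemma continuous_map_Euclidean_subtopology:
  assumes "openin (Euclidean_space n) S"
  shows "continuous_map (subtopology (Euclidean_space n) S) euclideanreal f \<longleftrightarrow> continuous_on S f"
  using subtopology_Euclidean_space[OF openin_subset[OF assms]] by simp

lemma openin_Euclidean_space_iff:
  "openin (Euclidean_space n) S \<longleftrightarrow> openin (top_of_set {x. \<forall>i\<ge>n. x i = 0}) S"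
  by (simp add: Euclidean_space_def euclidean_product_topology)

lemma tendsto_coordinatewise_iff:
  fixes l :: "nat \<Rightarrow> real"
  shows "(f \<longlongrightarrow> l) F \<longleftrightarrow> (\<forall>i. ((\<lambda>x. f x i) \<longlongrightarrow> l i) F)"
  using limitin_componentwise[of "\<lambda>_. euclidean" UNIV f l F]
  by (simp add: euclidean_product_topology)

text \<open>
  A basic open set of the product topology restricts finitely many coordinates, and those from \<open>n\<close>
  on are \<open>0\<close> throughout the space, so one radius for the first \<open>n\<close> coordinates suffices.
\<close>

lemma openin_Euclidean_space_box:
  assumes S: "openin (Euclidean_space n) S" and x: "x \<in> S"
  obtains e where "e > 0"
    "\<And>y. y \<in> topspace (Euclidean_space n) \<Longrightarrow> (\<And>i. i < n \<Longrightarrow> \<bar>y i - x i\<bar> < e) \<Longrightarrow> y \<in> S"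
proof -
  obtain T where T: "open T" "S = topspace (Euclidean_space n) \<inter> T"
    using S by (auto simp: openin_Euclidean_space_iff openin_open topspace_Euclidean_space)
  then have "openin (powertop_real UNIV) T" "x \<in> T"
    using x by (auto simp: euclidean_product_topology)
  then obtain U where U: "finite {i. U i \<noteq> UNIV}" "\<And>i. open (U i)" "x \<in> PiE UNIV U" "PiE UNIV U \<subseteq> T"
    unfolding openin_product_topology_alt by auto
  have "\<exists>e>0. \<forall>t. \<bar>t - x i\<bar> < e \<longrightarrow> t \<in> U i" for i
    using U(2)[of i] U(3) by (auto simp: open_real PiE_iff)
  then obtain e where e: "\<And>i. e i > 0" "\<And>i t. \<bar>t - x i\<bar> < e i \<Longrightarrow> t \<in> U i"
    by metis
  define d where "d = Min (insert 1 (e ` {..<n}))"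
  have d: "d > 0" "\<And>i. i < n \<Longrightarrow> d \<le> e i"
    using e(1) by (auto simp: d_def)
  show ?thesis
  proof
    show "d > 0" by (rule d)
  next
    fix y assume y: "y \<in> topspace (Euclidean_space n)" "\<And>i. i < n \<Longrightarrow> \<bar>y i - x i\<bar> < d"
    have "y i \<in> U i" for i
    proof (cases "i < n")
      case True
      then show ?thesis using y(2)[OF True] d(2)[OF True] e(2)[of "y i" i] by auto
    next
      case False
      have "x \<in> topspace (Euclidean_space n)" using x T by auto
      then have "y i = x i" using False y(1) by (simp add: topspace_Euclidean_space)
      then show ?thesis using e(1)[of i] e(2)[of "x i" i] by simp
    qed
    then show "y \<in> S" using U(4) y(1) T(2) by (auto simp: PiE_iff)
  qed
qed

lemma eventually_line_in_open:
  assumes S: "openin (Euclidean_space n) S" and x: "x \<in> S" and i: "i < n"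
  shows "\<forall>\<^sub>F t in nhds (x i). x(i := t) \<in> S"
proof -
  obtain e where e: "e > 0"
    "\<And>y. y \<in> topspace (Euclidean_space n) \<Longrightarrow> (\<And>i. i < n \<Longrightarrow> \<bar>y i - x i\<bar> < e) \<Longrightarrow> y \<in> S"
    using openin_Euclidean_space_box[OF S x] by metis
  have "x(i := t) \<in> topspace (Euclidean_space n)" for t
    using openin_subset[OF S] x i by (auto simp: topspace_Euclidean_space)
  then have "\<forall>t. dist t (x i) < e \<longrightarrow> x(i := t) \<in> S"
    using e by (auto simp: dist_real_def)
  then show ?thesis using e(1) unfolding eventually_nhds_metric by blast
qed

definition has_partial ::
    "(nat \<Rightarrow> real) set \<Rightarrow> nat \<Rightarrow> ((nat \<Rightarrow> real) \<Rightarrow> real) \<Rightarrow> ((nat \<Rightarrow> real) \<Rightarrow> real) \<Rightarrow> bool" where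
  "has_partial S i f g \<longleftrightarrow> (\<forall>x\<in>S. ((\<lambda>t. f (x(i := t))) has_real_derivative g x) (at (x i)))"

lemma has_partialD:
  "has_partial S i f g \<Longrightarrow> x \<in> S \<Longrightarrow> ((\<lambda>t. f (x(i := t))) has_real_derivative g x) (at (x i))"
  by (simp add: has_partial_def)

lemma Ck_on_SucI:
  "Ck_on n 0 S f \<Longrightarrow> (\<And>i. i < n \<Longrightarrow> \<exists>g. has_partial S i f g \<and> Ck_on n k S g) \<Longrightarrow> Ck_on n (Suc k) S f"
  by (simp add: has_partial_def)

lemma Ck_on_SucE:
  assumes "Ck_on n (Suc k) S f" "i < n"
  obtains g where "has_partial S i f g" "Ck_on n k S g"
  using assms by (auto simp: has_partial_def)

lemma Ck_on_imp_continuous: "Ck_on n k S f \<Longrightarrow> Ck_on n 0 S f"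
  by (cases k) auto

lemma Ck_on_0_iff: "openin (Euclidean_space n) S \<Longrightarrow> Ck_on n 0 S f \<longleftrightarrow> continuous_on S f"
  by (simp add: continuous_map_Euclidean_subtopology)

declare Ck_on.simps [simp del]

lemma Ck_on_continuous_on: "openin (Euclidean_space n) S \<Longrightarrow> Ck_on n k S f \<Longrightarrow> continuous_on S f"
  using Ck_on_imp_continuous Ck_on_0_iff by blast

lemma Ck_on_SucD: "Ck_on n (Suc k) S f \<Longrightarrow> Ck_on n k S f"
proof (induction k arbitrary: f)
  case 0
  then show ?case by (rule Ck_on_imp_continuous)
next
  case (Suc k)
  show ?case
    by (meson Suc.IH Suc.prems Ck_on_SucI Ck_on_SucE Ck_on_imp_continuous)
qed

text \<open>
  A partial derivative also depends on the values near the point; these agree as \<open>S\<close> is open.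
\<close>

lemma Ck_on_cong:
  assumes S: "openin (Euclidean_space n) S" and fg: "\<And>x. x \<in> S \<Longrightarrow> f x = g x" and f: "Ck_on n k S f"
  shows "Ck_on n k S g"
proof -
  have c: "continuous_on S g"
    using Ck_on_continuous_on[OF S f] fg by (simp cong: continuous_on_cong)
  have d: "((\<lambda>t. g (x(i := t))) has_real_derivative D) (at (x i))"
    if D: "((\<lambda>t. f (x(i := t))) has_real_derivative D) (at (x i))" and x: "x \<in> S" "i < n" for x i D
  proof -
    have "\<forall>\<^sub>F t in nhds (x i). f (x(i := t)) = g (x(i := t))"
      using eventually_line_in_open[OF S x] by eventually_elim (rule fg)
    from DERIV_cong_ev[OF refl this refl, of D] show ?thesis using D by simp
  qed
  show ?thesis
  proof (cases k)
    case 0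
    then show ?thesis using c Ck_on_0_iff[OF S] by blast
  next
    case (Suc l)
    have "has_partial S i g h" if "has_partial S i f h" "i < n" for i h
      using that d by (simp add: has_partial_def)
    then show ?thesis using f c unfolding Suc
      by (metis Ck_on_SucI Ck_on_SucE Ck_on_0_iff[OF S])
  qed
qed

lemma Ck_on_subset:
  assumes "openin (Euclidean_space n) S" "openin (Euclidean_space n) T" "T \<subseteq> S"
  shows "Ck_on n k S f \<Longrightarrow> Ck_on n k T f"
proof (induction k arbitrary: f)
  case 0
  then show ?case
    using Ck_on_0_iff[OF assms(1)] Ck_on_0_iff[OF assms(2)] continuous_on_subset[OF _ assms(3)] by metis
next
  case (Suc k)
  have "\<exists>g. has_partial T i f g \<and> Ck_on n k T g"
    if i: "i < n" for i
  proof -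
    obtain g where g: "has_partial S i f g" "Ck_on n k S g"
      using Ck_on_SucE[OF Suc.prems i] .
    then have "has_partial T i f g" using assms(3) by (auto simp: has_partial_def)
    then show ?thesis using Suc.IH g(2) by blast
  qed
  moreover have "Ck_on n 0 T f"
    using Ck_on_continuous_on[OF assms(1) Suc.prems] continuous_on_subset[OF _ assms(3)] Ck_on_0_iff[OF assms(2)]
    by blast
  ultimately show ?case by (intro Ck_on_SucI)
qed

text \<open>
  The partial derivatives given on the small sets agree where they overlap, both being the value of
  \<^const>\<open>deriv\<close>, and so glue together.
\<close>

lemma Ck_on_local:
  assumes S: "openin (Euclidean_space n) S"
  shows "(\<And>x. x \<in> S \<Longrightarrow> \<exists>T. openin (Euclidean_space n) T \<and> x \<in> T \<and> T \<subseteq> S \<and> Ck_on n k T f)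
    \<Longrightarrow> Ck_on n k S f"
proof (induction k arbitrary: f)
  case 0
  have "continuous (at x within S) f" if x: "x \<in> S" for x
  proof -
    obtain T where T: "openin (Euclidean_space n) T" "x \<in> T" "T \<subseteq> S" "Ck_on n 0 T f"
      using 0[OF x] by metis
    obtain O' where O': "open O'" "T = {x. \<forall>i\<ge>n. x i = 0} \<inter> O'"
      using T(1) by (auto simp: openin_Euclidean_space_iff openin_open)
    have "S \<subseteq> {x. \<forall>i\<ge>n. x i = 0}"
      using openin_subset[OF S] by (simp add: topspace_Euclidean_space)
    then have "at x within S = at x within T"
      using T(2,3) O' by (intro at_within_nhd[of x O']) auto
    moreover have "continuous (at x within T) f"
      using Ck_on_0_iff[OF T(1)] T(2,4) continuous_on_eq_continuous_within by blast
    ultimately show ?thesis by simp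
  qed
  then show ?case using Ck_on_0_iff[OF S] continuous_on_eq_continuous_within by blast
next
  case (Suc k)
  have "Ck_on n 0 S f"
  proof -
    have "\<And>x. x \<in> S \<Longrightarrow> \<exists>T. openin (Euclidean_space n) T \<and> x \<in> T \<and> T \<subseteq> S \<and> Ck_on n k T f"
      using Suc.prems Ck_on_SucD by meson
    then show ?thesis using Suc.IH Ck_on_imp_continuous by blast
  qed
  moreover have "\<exists>g. has_partial S i f g \<and> Ck_on n k S g"
    if i: "i < n" for i
  proof -
    define g where "g x = deriv (\<lambda>t. f (x(i := t))) (x i)" for x
    have 1: "\<exists>T. openin (Euclidean_space n) T \<and> x \<in> T \<and> T \<subseteq> S \<and> Ck_on n k T g
        \<and> has_partial T i f g" if x: "x \<in> S" for x
    proof -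
      obtain T where T: "openin (Euclidean_space n) T" "x \<in> T" "T \<subseteq> S" "Ck_on n (Suc k) T f"
        using Suc.prems[OF x] by blast
      obtain h where h: "has_partial T i f h"
        "Ck_on n k T h"
        using Ck_on_SucE[OF T(4) i] .
      have hg: "h x = g x" if "x \<in> T" for x
        using DERIV_imp_deriv[OF has_partialD[OF h(1) that]] by (simp add: g_def)
      then have "has_partial T i f g" using h(1) by (simp add: has_partial_def)
      then show ?thesis using T(1-3) Ck_on_cong[OF T(1) hg h(2)] by blast
    qed
    have "Ck_on n k S g" using 1 by (intro Suc.IH) blast
    moreover have "has_partial S i f g" using 1 unfolding has_partial_def by blast
    ultimately show ?thesis by blast
  qed
  ultimately show ?case by (rule Ck_on_SucI)
qed

lemma Ck_on_const: "openin (Euclidean_space n) S \<Longrightarrow> Ck_on n k S (\<lambda>x. c)"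
proof (induction k arbitrary: c)
  case 0
  then show ?case by (simp add: Ck_on_0_iff)
next
  case (Suc k)
  show ?case
    using Suc Ck_on_imp_continuous[OF Suc.IH]
    by (intro Ck_on_SucI exI[of _ "\<lambda>x. 0"]) (auto simp: has_partial_def)
qed

lemma Ck_on_coordinate:
  assumes S: "openin (Euclidean_space n) S"
  shows "Ck_on n k S (\<lambda>x. x i)"
proof (cases k)
  case 0
  then show ?thesis
    using Ck_on_0_iff[OF S, of "\<lambda>x. x i"] continuous_on_subset[OF continuous_on_product_coordinates, of S i] by simp
next
  case (Suc l)
  have "\<exists>g. has_partial S j (\<lambda>x. x i) g \<and> Ck_on n l S g" for j
    by (cases "i = j") (auto simp: has_partial_def intro!: exI[of _ "\<lambda>x. if i = j then 1 else 0"] Ck_on_const[OF S])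
  moreover have "Ck_on n 0 S (\<lambda>x. x i)"
    using Ck_on_0_iff[OF S, of "\<lambda>x. x i"] continuous_on_subset[OF continuous_on_product_coordinates, of S i] by simp
  ultimately show ?thesis unfolding Suc by (intro Ck_on_SucI)
qed

lemma Ck_on_add:
  assumes S: "openin (Euclidean_space n) S"
  shows "Ck_on n k S f \<Longrightarrow> Ck_on n k S g \<Longrightarrow> Ck_on n k S (\<lambda>x. f x + g x)"
proof (induction k arbitrary: f g)
  case 0
  then show ?case unfolding Ck_on_0_iff[OF S] by (intro continuous_intros)
next
  case (Suc k)
  have "\<exists>h. has_partial S i (\<lambda>x. f x + g x) h \<and> Ck_on n k S h"
    if i: "i < n" for i
  proof -
    obtain f' where f': "has_partial S i f f'"
      "Ck_on n k S f'" using Ck_on_SucE[OF Suc.prems(1) i] .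
    obtain g' where g': "has_partial S i g g'"
      "Ck_on n k S g'" using Ck_on_SucE[OF Suc.prems(2) i] .
    have "has_partial S i (\<lambda>x. f x + g x) (\<lambda>x. f' x + g' x)"
      using f'(1) g'(1) by (simp add: has_partial_def DERIV_add)
    then show ?thesis using Suc.IH[OF f'(2) g'(2)] by blast
  qed
  moreover have "Ck_on n 0 S (\<lambda>x. f x + g x)"
    using Suc.prems[THEN Ck_on_continuous_on[OF S]] Ck_on_0_iff[OF S] continuous_on_add by blast
  ultimately show ?case by (intro Ck_on_SucI)
qed

lemma Ck_on_mult:
  assumes S: "openin (Euclidean_space n) S"
  shows "Ck_on n k S f \<Longrightarrow> Ck_on n k S g \<Longrightarrow> Ck_on n k S (\<lambda>x. f x * g x)"
proof (induction k arbitrary: f g)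
  case 0
  then show ?case unfolding Ck_on_0_iff[OF S] by (intro continuous_intros)
next
  case (Suc k)
  have "\<exists>h. has_partial S i (\<lambda>x. f x * g x) h \<and> Ck_on n k S h"
    if i: "i < n" for i
  proof -
    obtain f' where f': "has_partial S i f f'"
      "Ck_on n k S f'" using Ck_on_SucE[OF Suc.prems(1) i] .
    obtain g' where g': "has_partial S i g g'"
      "Ck_on n k S g'" using Ck_on_SucE[OF Suc.prems(2) i] .
    have "has_partial S i (\<lambda>x. f x * g x) (\<lambda>x. f' x * g x + g' x * f x)"
      unfolding has_partial_def
    proof
      fix x assume "x \<in> S"
      then show "((\<lambda>t. f (x(i := t)) * g (x(i := t))) has_real_derivative f' x * g x + g' x * f x) (at (x i))"
        using DERIV_mult[OF has_partialD[OF f'(1)] has_partialD[OF g'(1)], of x x] by simp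
    qed
    moreover have "Ck_on n k S (\<lambda>x. f' x * g x + g' x * f x)"
      using f'(2) g'(2) Suc.prems[THEN Ck_on_SucD] by (intro Ck_on_add[OF S] Suc.IH)
    ultimately show ?thesis by blast
  qed
  moreover have "Ck_on n 0 S (\<lambda>x. f x * g x)"
    using Suc.prems[THEN Ck_on_continuous_on[OF S]] Ck_on_0_iff[OF S] continuous_on_mult by blast
  ultimately show ?case by (intro Ck_on_SucI)
qed

lemma Ck_on_sum:
  assumes S: "openin (Euclidean_space n) S"
  shows "(\<And>i. i \<in> I \<Longrightarrow> Ck_on n k S (f i)) \<Longrightarrow> Ck_on n k S (\<lambda>x. \<Sum>i\<in>I. f i x)"
proof (induction I rule: infinite_finite_induct)
  case (insert a F)
  have "Ck_on n k S (\<lambda>x. f a x + (\<Sum>i\<in>F. f i x))" using insert by (intro Ck_on_add[OF S]) auto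
  then show ?case using insert(1,2) by simp
qed (auto simp: Ck_on_const[OF S])

text \<open>
  When a set of functions of one variable is closed under differentiation, the chain rule leads to
  further members of the set only, and a single induction on the order of differentiability treats
  them all.  Reciprocals and the functions \<open>exp (- 1 / t)\<close> of bump functions are two instances.
\<close>

lemma Ck_on_compose_derivative_closed:
  assumes S: "openin (Euclidean_space n) S"
    and H: "\<And>h. h \<in> H \<Longrightarrow> \<exists>h'\<in>H. \<forall>t\<in>D. (h has_real_derivative h' t) (at t)"
    and fD: "\<And>x. x \<in> S \<Longrightarrow> f x \<in> D"
  shows "h \<in> H \<Longrightarrow> Ck_on n k S f \<Longrightarrow> Ck_on n k S (\<lambda>x. h (f x))"
proof (induction k arbitrary: h)
  have cont: "continuous_on S (\<lambda>x. h (f x))" if "h \<in> H" "continuous_on S f" for h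
  proof -
    have "continuous_on D h"
      using H[OF that(1)] DERIV_isCont continuous_at_imp_continuous_on by blast
    then show ?thesis using that(2) fD by (auto intro: continuous_on_compose2)
  qed
  {
    case 0
    then show ?case using cont Ck_on_0_iff[OF S] by blast
  next
    case (Suc k)
    obtain h' where h': "h' \<in> H" "\<And>t. t \<in> D \<Longrightarrow> (h has_real_derivative h' t) (at t)"
      using H[OF Suc.prems(1)] by blast
    have "\<exists>g. has_partial S i (\<lambda>x. h (f x)) g \<and> Ck_on n k S g"
      if i: "i < n" for i
    proof -
      obtain f' where f': "has_partial S i f f'"
        "Ck_on n k S f'" using Ck_on_SucE[OF Suc.prems(2) i] .
      have "((\<lambda>t. h (f (x(i := t)))) has_real_derivative h' (f x) * f' x) (at (x i))" if "x \<in> S" for x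
        using DERIV_chain2[OF _ has_partialD[OF f'(1) that], of h "h' (f x)"] h'(2)[OF fD[OF that]] by simp
      then have "has_partial S i (\<lambda>x. h (f x)) (\<lambda>x. h' (f x) * f' x)" by (simp add: has_partial_def)
      moreover have "Ck_on n k S (\<lambda>x. h' (f x) * f' x)"
        using Suc.IH[OF h'(1) Ck_on_SucD[OF Suc.prems(2)]] f'(2) by (rule Ck_on_mult[OF S])
      ultimately show ?thesis by blast
    qed
    moreover have "Ck_on n 0 S (\<lambda>x. h (f x))"
      using cont[OF Suc.prems(1)] Ck_on_continuous_on[OF S Suc.prems(2)] Ck_on_0_iff[OF S] by blast
    ultimately show ?case by (intro Ck_on_SucI)
  }
qed

lemma Ck_on_inverse:
  assumes S: "openin (Euclidean_space n) S" and f: "Ck_on n k S f" and nz: "\<And>x. x \<in> S \<Longrightarrow> f x \<noteq> 0"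
  shows "Ck_on n k S (\<lambda>x. inverse (f x))"
proof -
  define H :: "(real \<Rightarrow> real) set" where "H = {\<lambda>t. c * inverse t ^ m | c m. True}"
  have "\<exists>h'\<in>H. \<forall>t\<in>-{0}. (h has_real_derivative h' t) (at t)" if hH: "h \<in> H" for h
  proof -
    obtain c m where h: "h = (\<lambda>t. c * inverse t ^ m)" using hH unfolding H_def by blast
    have "(h has_real_derivative (- c * real m) * inverse t ^ (m + 1)) (at t)" if "t \<noteq> 0" for t
    proof -
      have eq: "c * (real m * (- (inverse t ^ Suc (Suc 0)) * inverse t ^ (m - Suc 0)))
          = (- c * real m) * inverse t ^ (m + 1)"
        by (cases m) simp_all
      show ?thesis
        using DERIV_cmult[OF DERIV_power[OF DERIV_inverse[OF that]], of c m] unfolding h eq .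
    qed
    moreover have "(\<lambda>t. (- c * real m) * inverse t ^ (m + 1)) \<in> H"
      unfolding H_def by (intro CollectI exI[of _ "- c * real m"] exI[of _ "m + 1"]) simp
    ultimately show ?thesis by (intro bexI) auto
  qed
  moreover have "(\<lambda>t. inverse t) \<in> H"
    unfolding H_def by (auto intro!: exI[of _ 1])
  ultimately show ?thesis
    using Ck_on_compose_derivative_closed[OF S, of H "-{0}" f "\<lambda>t. inverse t" k] f nz by auto
qed

text \<open>
  For \<open>p = 1\<close> this is the classical smooth function that is flat at \<open>0\<close>.  The polynomial factor
  makes the family closed under differentiation.
\<close>

definition flat :: "real poly \<Rightarrow> real \<Rightarrow> real" where
  "flat p t = (if t > 0 then poly p (inverse t) * exp (- inverse t) else 0)"

lemma poly_times_exp_minus_tendsto_0: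
  "((\<lambda>y. poly p y * exp (- y)) \<longlongrightarrow> (0::real)) at_top"
proof -
  have "((\<lambda>y. \<Sum>i\<le>degree p. coeff p i * (y ^ i / exp y)) \<longlongrightarrow> (\<Sum>i\<le>degree p. coeff p i * 0)) at_top"
    by (intro tendsto_sum tendsto_mult tendsto_const tendsto_power_div_exp_0)
  moreover have "(\<lambda>y. poly p y * exp (- y)) = (\<lambda>y. \<Sum>i\<le>degree p. coeff p i * (y ^ i / exp y))"
    by (simp add: poly_altdef sum_distrib_right exp_minus divide_inverse mult.assoc)
  ultimately show ?thesis by simp
qed

text \<open>
  At \<open>0\<close> the difference quotient from the right has the same shape, a polynomial in \<open>1 / t\<close>
  times \<open>exp (- 1 / t)\<close>, and exponential decay wins.
\<close>

lemma flat_has_derivative: "(flat p has_real_derivative flat ([:0, 0, 1:] * (p - pderiv p)) t) (at t)"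
proof (cases t "0::real" rule: linorder_cases)
  case less
  have "\<forall>\<^sub>F s in nhds t. s < 0" using less eventually_nhds_in_open[of "{..<0}" t] by simp
  then have "\<forall>\<^sub>F s in nhds t. flat p s = 0" by eventually_elim (auto simp: flat_def)
  then have "(flat p has_real_derivative 0) (at t)" using DERIV_cong_ev[OF refl _ refl, of "flat p" "\<lambda>_. 0" t 0] by auto
  then show ?thesis using less by (simp add: flat_def)
next
  case equal
  have "((\<lambda>t. poly ([:0,1:] * p) (inverse t) * exp (- inverse t)) \<longlongrightarrow> 0) (at_right 0)"
    using filterlim_compose[OF poly_times_exp_minus_tendsto_0[of "[:0,1:] * p"] filterlim_inverse_at_top_right] .
  moreover have "\<forall>\<^sub>F h in at_right 0. poly ([:0,1:] * p) (inverse h) * exp (- inverse h) = (flat p (0 + h) - flat p 0) / h"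
    by (auto simp: eventually_at_right_field flat_def divide_simps intro!: exI[of _ 1])
  ultimately have r: "((\<lambda>h. (flat p (0 + h) - flat p 0) / h) \<longlongrightarrow> 0) (at_right 0)"
    by (rule Lim_transform_eventually)
  have "\<forall>\<^sub>F h in at_left 0. 0 = (flat p (0 + h) - flat p 0) / h"
    by (auto simp: eventually_at_left_field flat_def intro!: exI[of _ "-1"])
  then have l: "((\<lambda>h. (flat p (0 + h) - flat p 0) / h) \<longlongrightarrow> 0) (at_left 0)"
    by (rule Lim_transform_eventually[OF tendsto_const])
  have "(flat p has_real_derivative 0) (at 0)"
    unfolding DERIV_def using filterlim_split_at[OF l r] by simp
  then show ?thesis using equal by (simp add: flat_def)
next
  case greater
  have "((\<lambda>t. poly p (inverse t) * exp (- inverse t)) has_real_derivative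
      flat ([:0, 0, 1:] * (p - pderiv p)) t) (at t)"
    using greater
    by (auto intro!: derivative_eq_intros DERIV_chain2[OF poly_DERIV] simp: flat_def algebra_simps power2_eq_square)
  moreover have "\<forall>\<^sub>F s in nhds t. s > 0" using greater eventually_nhds_in_open[of "{0<..}" t] by simp
  then have "\<forall>\<^sub>F s in nhds t. poly p (inverse s) * exp (- inverse s) = flat p s" by eventually_elim (auto simp: flat_def)
  ultimately show ?thesis using DERIV_cong_ev[OF refl _ refl, of "\<lambda>t. poly p (inverse t) * exp (- inverse t)" "flat p" t] by blast
qed

lemma Ck_on_flat:
  assumes "openin (Euclidean_space n) S" "Ck_on n k S f"
  shows "Ck_on n k S (\<lambda>x. flat p (f x))"
  using Ck_on_compose_derivative_closed[OF assms(1), of "range flat" UNIV f "flat p" k] assms(2)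
    flat_has_derivative by blast

text \<open>
  Walking from \<open>\<gamma> t0\<close> to \<open>\<gamma> t\<close> along the coordinate axes, one coordinate at a time, reduces the
  chain rule to the mean value theorem in a single variable.
\<close>

lemma has_real_derivative_along_curve:
  fixes \<gamma> :: "real \<Rightarrow> nat \<Rightarrow> real"
  assumes S: "openin (Euclidean_space n) S"
    and g: "\<And>i. i < n \<Longrightarrow> has_partial S i f (g i)" "\<And>i. i < n \<Longrightarrow> continuous_on S (g i)"
    and \<gamma>: "\<And>t. \<gamma> t \<in> topspace (Euclidean_space n)" "\<gamma> t0 \<in> S"
      "\<And>i. i < n \<Longrightarrow> ((\<lambda>t. \<gamma> t i) has_real_derivative \<gamma>' i) (at t0)"
  shows "((\<lambda>t. f (\<gamma> t)) has_real_derivative (\<Sum>i<n. g i (\<gamma> t0) * \<gamma>' i)) (at t0)"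
proof -
  define step where "step j t = (\<lambda>i. if i < j then \<gamma> t i else \<gamma> t0 i)" for j t
  have "((\<lambda>t. f (step j t)) has_real_derivative (\<Sum>i<j. g i (\<gamma> t0) * \<gamma>' i)) (at t0)" if "j \<le> n" for j
    using that
  proof (induction j)
    case 0
    then show ?case by (simp add: step_def)
  next
    case (Suc j)
    then have j: "j < n" by simp
    have cont\<gamma>: "isCont (\<lambda>t. \<gamma> t i) t0" if "i < n" for i
      using DERIV_isCont[OF \<gamma>(3)[OF that]] .
    obtain e where e: "e > 0"
      "\<And>y. y \<in> topspace (Euclidean_space n) \<Longrightarrow> (\<And>i. i < n \<Longrightarrow> \<bar>y i - \<gamma> t0 i\<bar> < e) \<Longrightarrow> y \<in> S"
      using openin_Euclidean_space_box[OF S \<gamma>(2)] by metis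
    have "\<forall>\<^sub>F t in nhds t0. \<forall>i\<in>{..<n}. \<bar>\<gamma> t i - \<gamma> t0 i\<bar> < e"
    proof (rule eventually_ball_finite)
      show "\<forall>i\<in>{..<n}. \<forall>\<^sub>F t in nhds t0. \<bar>\<gamma> t i - \<gamma> t0 i\<bar> < e"
      proof
        fix i assume "i \<in> {..<n}"
        then have "((\<lambda>t. \<gamma> t i) \<longlongrightarrow> \<gamma> t0 i) (nhds t0)"
          using cont\<gamma>[of i] tendsto_at_iff_tendsto_nhds[of "\<lambda>t. \<gamma> t i" t0] by (simp add: isCont_def)
        from tendstoD[OF this e(1)] show "\<forall>\<^sub>F t in nhds t0. \<bar>\<gamma> t i - \<gamma> t0 i\<bar> < e"
          by (simp add: dist_real_def)
      qed
    qed auto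
    then obtain d where d: "d > 0" "\<And>t i. \<bar>t - t0\<bar> < d \<Longrightarrow> i < n \<Longrightarrow> \<bar>\<gamma> t i - \<gamma> t0 i\<bar> < e"
      unfolding eventually_nhds_metric dist_real_def by auto
    \<comment> \<open>the mean value point on the segment along the \<open>j\<close>-th axis\<close>
    have "\<exists>s. \<bar>s - \<gamma> t0 j\<bar> \<le> \<bar>\<gamma> t j - \<gamma> t0 j\<bar> \<and>
        f (step (Suc j) t) - f (step j t) = g j ((step j t)(j := s)) * (\<gamma> t j - \<gamma> t0 j) \<and>
        (step j t)(j := s) \<in> S" if t: "\<bar>t - t0\<bar> < d" for t
    proof -
      have inS: "(step j t)(j := s) \<in> S" if "\<bar>s - \<gamma> t0 j\<bar> \<le> \<bar>\<gamma> t j - \<gamma> t0 j\<bar>" for s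
        using \<gamma>(1)[of t] \<gamma>(1)[of t0] d(2)[OF t] j that e(1)
        by (intro e(2)) (fastforce simp: step_def topspace_Euclidean_space)+
      have D: "((\<lambda>s. f ((step j t)(j := s))) has_real_derivative g j ((step j t)(j := s))) (at s)"
        if "\<bar>s - \<gamma> t0 j\<bar> \<le> \<bar>\<gamma> t j - \<gamma> t0 j\<bar>" for s
        using has_partialD[OF g(1)[OF j] inS[OF that]] by simp
      have ends: "step (Suc j) t = (step j t)(j := \<gamma> t j)" "step j t = (step j t)(j := \<gamma> t0 j)"
        by (auto simp: step_def fun_eq_iff less_Suc_eq)
      let ?h = "\<lambda>s. f ((step j t)(j := s))"
      have "\<exists>s. \<bar>s - \<gamma> t0 j\<bar> \<le> \<bar>\<gamma> t j - \<gamma> t0 j\<bar> \<and>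
        ?h (\<gamma> t j) - ?h (\<gamma> t0 j) = g j ((step j t)(j := s)) * (\<gamma> t j - \<gamma> t0 j)"
      proof (cases "\<gamma> t j" "\<gamma> t0 j" rule: linorder_cases)
        case less
        then obtain s where "\<gamma> t j < s" "s < \<gamma> t0 j"
          "?h (\<gamma> t0 j) - ?h (\<gamma> t j) = (\<gamma> t0 j - \<gamma> t j) * g j ((step j t)(j := s))"
          using MVT2[of "\<gamma> t j" "\<gamma> t0 j" ?h "\<lambda>s. g j ((step j t)(j := s))"] D by force
        then show ?thesis using less by (intro exI[of _ s]) (auto simp: algebra_simps)
      next
        case equal
        then show ?thesis by auto
      next
        case greater
        then obtain s where "\<gamma> t0 j < s" "s < \<gamma> t j"
          "?h (\<gamma> t j) - ?h (\<gamma> t0 j) = (\<gamma> t j - \<gamma> t0 j) * g j ((step j t)(j := s))"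
          using MVT2[of "\<gamma> t0 j" "\<gamma> t j" ?h "\<lambda>s. g j ((step j t)(j := s))"] D by force
        then show ?thesis using greater by (intro exI[of _ s]) (auto simp: algebra_simps)
      qed
      then show ?thesis using ends inS by metis
    qed
    then obtain s where s: "\<And>t. \<bar>t - t0\<bar> < d \<Longrightarrow> \<bar>s t - \<gamma> t0 j\<bar> \<le> \<bar>\<gamma> t j - \<gamma> t0 j\<bar>"
      "\<And>t. \<bar>t - t0\<bar> < d \<Longrightarrow> f (step (Suc j) t) - f (step j t) = g j ((step j t)(j := s t)) * (\<gamma> t j - \<gamma> t0 j)"
      "\<And>t. \<bar>t - t0\<bar> < d \<Longrightarrow> (step j t)(j := s t) \<in> S"
      by metis
    define \<xi> where "\<xi> t = (step j t)(j := s t)" for t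
    have near: "\<forall>\<^sub>F t in at t0. \<bar>t - t0\<bar> < d"
      using d(1) by (auto simp: eventually_at dist_real_def)
    have lim\<gamma>: "((\<lambda>t. \<gamma> t i) \<longlongrightarrow> \<gamma> t0 i) (at t0)" if "i < n" for i
      using cont\<gamma>[OF that] by (simp add: isCont_def)
    have "((\<lambda>t. s t - \<gamma> t0 j) \<longlongrightarrow> 0) (at t0)"
    proof (rule Lim_null_comparison)
      show "((\<lambda>t. \<bar>\<gamma> t j - \<gamma> t0 j\<bar>) \<longlongrightarrow> 0) (at t0)"
        using tendsto_rabs[OF tendsto_diff[OF lim\<gamma>[OF j] tendsto_const[of "\<gamma> t0 j"]]] by simp
      show "\<forall>\<^sub>F t in at t0. norm (s t - \<gamma> t0 j) \<le> \<bar>\<gamma> t j - \<gamma> t0 j\<bar>"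
        using near by eventually_elim (simp add: s(1))
    qed
    then have "(s \<longlongrightarrow> \<gamma> t0 j) (at t0)" using LIM_zero_cancel by blast
    then have "((\<lambda>t. \<xi> t i) \<longlongrightarrow> \<gamma> t0 i) (at t0)" for i
      using lim\<gamma>[of i] j by (cases "i = j"; cases "i < j") (simp_all add: \<xi>_def step_def)
    then have "(\<xi> \<longlongrightarrow> \<gamma> t0) (at t0)" by (simp add: tendsto_coordinatewise_iff)
    moreover have "\<forall>\<^sub>F t in at t0. \<xi> t \<in> S"
      using near unfolding \<xi>_def by eventually_elim (rule s(3))
    ultimately have lim: "((\<lambda>t. g j (\<xi> t)) \<longlongrightarrow> g j (\<gamma> t0)) (at t0)"
      using continuous_on_tendsto_compose[OF g(2)[OF j] _ \<gamma>(2)] by blast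
    have "((\<lambda>t. f (step (Suc j) t) - f (step j t)) has_real_derivative g j (\<gamma> t0) * \<gamma>' j) (at t0)"
      unfolding has_field_derivative_iff
    proof (rule Lim_transform_eventually)
      show "((\<lambda>t. g j (\<xi> t) * ((\<gamma> t j - \<gamma> t0 j) / (t - t0))) \<longlongrightarrow> g j (\<gamma> t0) * \<gamma>' j) (at t0)"
        using \<gamma>(3)[OF j] lim unfolding has_field_derivative_iff by (intro tendsto_mult)
      have st0: "step (Suc j) t0 = step j t0" by (auto simp: step_def)
      show "\<forall>\<^sub>F t in at t0. g j (\<xi> t) * ((\<gamma> t j - \<gamma> t0 j) / (t - t0)) =
          (f (step (Suc j) t) - f (step j t) - (f (step (Suc j) t0) - f (step j t0))) / (t - t0)"
        using near by eventually_elim (simp add: s(2) \<xi>_def st0)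
    qed
    from DERIV_add[OF this Suc.IH] j show ?case by (simp add: algebra_simps)
  qed
  from this[of n] have "((\<lambda>t. f (step n t)) has_real_derivative (\<Sum>i<n. g i (\<gamma> t0) * \<gamma>' i)) (at t0)" by simp
  moreover have "step n t = \<gamma> t" for t
    using \<gamma>(1)[of t] \<gamma>(1)[of t0] by (auto simp: step_def topspace_Euclidean_space)
  ultimately show ?thesis by simp
qed

text \<open>
  The partial derivatives of \<open>f \<circ> F\<close> are sums of products of functions one order less smooth,
  among them compositions of the same kind; hence the induction over all \<open>f\<close>.
\<close>

lemma Ck_on_compose:
  assumes S: "openin (Euclidean_space m) S" and T: "openin (Euclidean_space n) T"
    and F: "\<And>x. x \<in> S \<Longrightarrow> F x \<in> T"
  shows "(\<And>i. i < n \<Longrightarrow> Ck_on m k S (\<lambda>x. F x i)) \<Longrightarrow> Ck_on n k T f \<Longrightarrow> Ck_on m k S (\<lambda>x. f (F x))"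
proof (induction k arbitrary: f)
  have cont: "Ck_on m 0 S (\<lambda>x. f (F x))"
    if "\<And>i. i < n \<Longrightarrow> continuous_on S (\<lambda>x. F x i)" "continuous_on T f" for f
  proof -
    have "continuous_on S (\<lambda>x. F x i)" for i
    proof (cases "i < n")
      case False
      have "F x i = 0" if "x \<in> S" for x
        using F[OF that] openin_subset[OF T] False by (auto simp: topspace_Euclidean_space)
      then show ?thesis by (simp cong: continuous_on_cong)
    qed (rule that)
    then have "continuous_on S F" by (rule continuous_on_coordinatewise_then_product)
    then show ?thesis
      using that(2) F Ck_on_0_iff[OF S, of "\<lambda>x. f (F x)"] continuous_on_compose2[of T f S F] by blast
  qed
  {
    case 0
    then show ?case
      using cont Ck_on_continuous_on[OF S] Ck_on_continuous_on[OF T] by metis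
  next
    case (Suc k)
    have "\<exists>g. has_partial T i f g \<and> Ck_on n k T g" if "i < n" for i
      by (rule Ck_on_SucE[OF Suc.prems(2) that]) blast
    then obtain g where g: "\<And>i. i < n \<Longrightarrow> has_partial T i f (g i)" "\<And>i. i < n \<Longrightarrow> Ck_on n k T (g i)"
      by metis
    show ?case
    proof (rule Ck_on_SucI)
      show "Ck_on m 0 S (\<lambda>x. f (F x))"
        using cont Suc.prems Ck_on_continuous_on[OF S] Ck_on_continuous_on[OF T] by metis
    next
      fix j assume j: "j < m"
      have "\<exists>G. has_partial S j (\<lambda>x. F x i) G \<and> Ck_on m k S G" if "i < n" for i
        by (rule Ck_on_SucE[OF Suc.prems(1)[OF that] j]) blast
      then obtain G where G: "\<And>i. i < n \<Longrightarrow> has_partial S j (\<lambda>x. F x i) (G i)" "\<And>i. i < n \<Longrightarrow> Ck_on m k S (\<lambda>x. G i x)"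
        by metis
      have "has_partial S j (\<lambda>x. f (F x)) (\<lambda>x. \<Sum>i<n. g i (F x) * G i x)"
        unfolding has_partial_def
      proof
        fix x assume x: "x \<in> S"
        \<comment> \<open>off \<open>S\<close> the map \<open>F\<close> may leave the Euclidean space, so the curve is frozen there\<close>
        define \<gamma> where "\<gamma> t = (if x(j := t) \<in> S then F (x(j := t)) else F x)" for t
        have ev: "\<forall>\<^sub>F t in nhds (x j). \<gamma> t = F (x(j := t))"
          using eventually_line_in_open[OF S x j] by eventually_elim (simp add: \<gamma>_def)
        have \<gamma>0: "\<gamma> (x j) = F x" by (simp add: \<gamma>_def)
        have "((\<lambda>t. f (\<gamma> t)) has_real_derivative (\<Sum>i<n. g i (\<gamma> (x j)) * G i x)) (at (x j))"
        proof (rule has_real_derivative_along_curve[OF T g(1)])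
          show "\<gamma> t \<in> topspace (Euclidean_space n)" for t
            using F x openin_subset[OF T] by (auto simp: \<gamma>_def)
          show "\<gamma> (x j) \<in> T" using F x by (simp add: \<gamma>0)
          show "continuous_on T (g i)" if "i < n" for i
            using Ck_on_continuous_on[OF T g(2)[OF that]] .
          show "((\<lambda>t. \<gamma> t i) has_real_derivative G i x) (at (x j))" if "i < n" for i
          proof -
            have "\<forall>\<^sub>F t in nhds (x j). F (x(j := t)) i = \<gamma> t i"
              using ev by eventually_elim simp
            from DERIV_cong_ev[OF refl this refl, of "G i x"] show ?thesis
              using has_partialD[OF G(1)[OF that] x] by simp
          qed
        qed
        moreover have "\<forall>\<^sub>F t in nhds (x j). f (\<gamma> t) = f (F (x(j := t)))"
          using ev by eventually_elim simp
        from DERIV_cong_ev[OF refl this refl]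
        have "((\<lambda>t. f (\<gamma> t)) has_real_derivative D) (at (x j)) \<longleftrightarrow>
          ((\<lambda>t. f (F (x(j := t)))) has_real_derivative D) (at (x j))" for D .
        ultimately show "((\<lambda>t. f (F (x(j := t)))) has_real_derivative (\<Sum>i<n. g i (F x) * G i x)) (at (x j))"
          by (simp add: \<gamma>0)
      qed
      moreover have "Ck_on m k S (\<lambda>x. \<Sum>i<n. g i (F x) * G i x)"
      proof (intro Ck_on_sum[OF S] Ck_on_mult[OF S])
        fix i assume "i \<in> {..<n}"
        then have i: "i < n" by simp
        show "Ck_on m k S (\<lambda>x. g i (F x))"
          using Suc.IH[OF Ck_on_SucD[OF Suc.prems(1)] g(2)[OF i]] .
        show "Ck_on m k S (\<lambda>x. G i x)" by (rule G(2)[OF i])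
      qed
      ultimately show "\<exists>g. has_partial S j (\<lambda>x. f (F x)) g \<and> Ck_on m k S g" by blast
    qed
  }
qed

section \<open>Smooth functions on manifolds\<close>

lemma Cinf_on_cong:
  "openin (Euclidean_space n) S \<Longrightarrow> (\<And>x. x \<in> S \<Longrightarrow> f x = g x) \<Longrightarrow> Cinf_on n S f \<Longrightarrow> Cinf_on n S g"
  unfolding Cinf_on_def using Ck_on_cong by meson

lemma Cinf_on_subset:
  "openin (Euclidean_space n) S \<Longrightarrow> openin (Euclidean_space n) T \<Longrightarrow> T \<subseteq> S \<Longrightarrow> Cinf_on n S f \<Longrightarrow> Cinf_on n T f"
  unfolding Cinf_on_def using Ck_on_subset by meson

lemma Cinf_on_local:
  assumes "openin (Euclidean_space n) S"
    and "\<And>x. x \<in> S \<Longrightarrow> \<exists>T. openin (Euclidean_space n) T \<and> x \<in> T \<and> T \<subseteq> S \<and> Cinf_on n T f"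
  shows "Cinf_on n S f"
  unfolding Cinf_on_def
proof
  fix k
  show "Ck_on n k S f"
    using assms(2) by (intro Ck_on_local[OF assms(1)]) (metis Cinf_on_def)
qed

lemma Cinf_on_compose:
  assumes "openin (Euclidean_space m) S" "openin (Euclidean_space n) T"
    and "\<And>x. x \<in> S \<Longrightarrow> F x \<in> T"
    and "\<And>i. i < n \<Longrightarrow> Cinf_on m S (\<lambda>x. F x i)" "Cinf_on n T f"
  shows "Cinf_on m S (\<lambda>x. f (F x))"
  using Ck_on_compose[OF assms(1,2), of F] assms(3-5) unfolding Cinf_on_def by meson



context
  fixes M :: "'m::{t2_space, second_countable_topology} manifold"
  assumes M: "smooth_manifold M"
begin

lemma chartD:
  assumes "(U, \<phi>) \<in> charts M"
  shows chart_open: "open U"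
    and chart_inj: "inj_on \<phi> U"
    and chart_image_open: "open W \<Longrightarrow> W \<subseteq> U \<Longrightarrow> openin (Euclidean_space (mdim M)) (\<phi> ` W)"
    and chart_inverse_continuous: "continuous_on (\<phi> ` U) (inv_into U \<phi>)"
proof -
  have U: "open U" and o: "openin (Euclidean_space (mdim M)) (\<phi> ` U)"
    and h: "homeomorphic_map (top_of_set U) (subtopology (Euclidean_space (mdim M)) (\<phi> ` U)) \<phi>"
    using M assms unfolding smooth_manifold_def by fast+
  show "open U" by fact
  show inj: "inj_on \<phi> U"
    using h by (simp add: homeomorphic_map_def)
  have eq: "subtopology (Euclidean_space (mdim M)) (\<phi> ` U) = top_of_set (\<phi> ` U)"
    by (rule subtopology_Euclidean_space[OF openin_subset[OF o]])
  have c: "continuous_on U \<phi>"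
    using homeomorphic_imp_continuous_map[OF h] by (simp add: eq)
  have om: "openin (subtopology (Euclidean_space (mdim M)) (\<phi> ` U)) (\<phi> ` W)" if "openin (top_of_set U) W" for W
    using homeomorphic_imp_open_map[OF h] that by (simp add: open_map_def)
  show "openin (Euclidean_space (mdim M)) (\<phi> ` W)" if "open W" "W \<subseteq> U" for W
    using om[of W] that openin_trans_full[OF _ o] by (simp add: openin_open_eq[OF U])
  show "continuous_on (\<phi> ` U) (inv_into U \<phi>)"
    using om inj by (intro continuous_on_inverse_open_map[OF c]) (auto simp: eq)
qed

lemma chart_inverse_mem:
  "(U, \<phi>) \<in> charts M \<Longrightarrow> W \<subseteq> U \<Longrightarrow> y \<in> \<phi> ` W \<Longrightarrow> inv_into U \<phi> y \<in> W"
  using chart_inj by (fastforce simp: inj_on_def subset_iff)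

lemma chart_exists:
  obtains U \<phi> where "(U, \<phi>) \<in> charts M" "x \<in> U"
proof -
  have "x \<in> (\<Union>(U, \<phi>)\<in>charts M. U)"
    using conjunct1[OF M[unfolded smooth_manifold_def]] by simp
  then show ?thesis using that by fastforce
qed

lemma smooth_on_in_chart:
  "smooth_on M W f \<Longrightarrow> (U, \<phi>) \<in> charts M \<Longrightarrow> Cinf_on (mdim M) (\<phi> ` (U \<inter> W)) (\<lambda>y. f (inv_into U \<phi> y))"
  unfolding smooth_on_def by blast

text \<open>
  Any closure property of smooth functions on open subsets of Euclidean space passes to manifolds;
  \<open>\<eta>\<close> stands for the inverse of a chart.
\<close>

lemma smooth_on_pointwise:
  assumes "open W"
    and "\<And>S \<eta>. openin (Euclidean_space (mdim M)) S \<Longrightarrow> \<eta> ` S \<subseteq> W \<Longrightarrow>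
      (\<And>j. j \<in> J \<Longrightarrow> Cinf_on (mdim M) S (\<lambda>y. f j (\<eta> y))) \<Longrightarrow> Cinf_on (mdim M) S (\<lambda>y. g (\<eta> y))"
    and "\<And>j. j \<in> J \<Longrightarrow> smooth_on M W (f j)"
  shows "smooth_on M W g"
  unfolding smooth_on_def
proof safe
  fix U \<phi> assume c: "(U, \<phi>) \<in> charts M"
  show "Cinf_on (mdim M) (\<phi> ` (U \<inter> W)) (\<lambda>y. g (inv_into U \<phi> y))"
  proof (rule assms(2))
    show "openin (Euclidean_space (mdim M)) (\<phi> ` (U \<inter> W))"
      using chart_open[OF c] assms(1) by (intro chart_image_open[OF c]) auto
    show "inv_into U \<phi> ` \<phi> ` (U \<inter> W) \<subseteq> W"
      using chart_inverse_mem[OF c, of "U \<inter> W"] by blast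
  qed (use smooth_on_in_chart[OF assms(3) c] in auto)
qed

lemma smooth_on_cong:
  "open W \<Longrightarrow> (\<And>x. x \<in> W \<Longrightarrow> f x = g x) \<Longrightarrow> smooth_on M W f \<Longrightarrow> smooth_on M W g"
  by (rule smooth_on_pointwise[of W "{()}" "\<lambda>_. f" g])
    (auto simp: image_subset_iff intro: Cinf_on_cong[of _ _ "\<lambda>y. f (_ y)"])

lemma smooth_on_const: "open W \<Longrightarrow> smooth_on M W (\<lambda>x. c)"
  by (rule smooth_on_pointwise[of W "{}"]) (auto simp: Cinf_on_def Ck_on_const)

lemma smooth_on_add:
  "open W \<Longrightarrow> smooth_on M W f \<Longrightarrow> smooth_on M W g \<Longrightarrow> smooth_on M W (\<lambda>x. f x + g x)"
  by (rule smooth_on_pointwise[of W "{f, g}" "\<lambda>h. h"]) (auto simp: Cinf_on_def Ck_on_add)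

lemma smooth_on_mult:
  "open W \<Longrightarrow> smooth_on M W f \<Longrightarrow> smooth_on M W g \<Longrightarrow> smooth_on M W (\<lambda>x. f x * g x)"
  by (rule smooth_on_pointwise[of W "{f, g}" "\<lambda>h. h"]) (auto simp: Cinf_on_def Ck_on_mult)

lemma smooth_on_diff:
  assumes "open W" "smooth_on M W f" "smooth_on M W g"
  shows "smooth_on M W (\<lambda>x. f x - g x)"
  using smooth_on_add[OF assms(1,2) smooth_on_mult[OF assms(1) smooth_on_const[OF assms(1), of "-1"] assms(3)]]
  by simp

lemma smooth_on_sum:
  "open W \<Longrightarrow> (\<And>i. i \<in> I \<Longrightarrow> smooth_on M W (f i)) \<Longrightarrow> smooth_on M W (\<lambda>x. \<Sum>i\<in>I. f i x)"
  by (rule smooth_on_pointwise[of W I f]) (auto simp: Cinf_on_def intro!: Ck_on_sum)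

lemma smooth_on_inverse:
  "open W \<Longrightarrow> smooth_on M W f \<Longrightarrow> (\<And>x. x \<in> W \<Longrightarrow> f x \<noteq> 0) \<Longrightarrow> smooth_on M W (\<lambda>x. inverse (f x))"
  by (rule smooth_on_pointwise[of W "{f}" "\<lambda>h. h"]) (auto simp: Cinf_on_def image_subset_iff intro!: Ck_on_inverse)

lemma smooth_on_subset:
  assumes "open W" "open W'" "W' \<subseteq> W" "smooth_on M W f"
  shows "smooth_on M W' f"
  unfolding smooth_on_def
proof safe
  fix U \<phi> assume c: "(U, \<phi>) \<in> charts M"
  show "Cinf_on (mdim M) (\<phi> ` (U \<inter> W')) (\<lambda>y. f (inv_into U \<phi> y))"
    using chart_open[OF c] assms(1-3)
    by (intro Cinf_on_subset[OF _ _ _ smooth_on_in_chart[OF assms(4) c]] chart_image_open[OF c]) auto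
qed

lemma smooth_on_local:
  assumes "open W" and loc: "\<And>x. x \<in> W \<Longrightarrow> \<exists>N. open N \<and> x \<in> N \<and> smooth_on M (N \<inter> W) f"
  shows "smooth_on M W f"
  unfolding smooth_on_def
proof safe
  fix U \<phi> assume c: "(U, \<phi>) \<in> charts M"
  show "Cinf_on (mdim M) (\<phi> ` (U \<inter> W)) (\<lambda>y. f (inv_into U \<phi> y))"
  proof (rule Cinf_on_local)
    show "openin (Euclidean_space (mdim M)) (\<phi> ` (U \<inter> W))"
      using chart_open[OF c] assms(1) by (intro chart_image_open[OF c]) auto
    fix y assume "y \<in> \<phi> ` (U \<inter> W)"
    then obtain x where x: "x \<in> U" "x \<in> W" "y = \<phi> x" by auto
    obtain N where N: "open N" "x \<in> N" "smooth_on M (N \<inter> W) f" using loc[OF x(2)] by blast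
    have "openin (Euclidean_space (mdim M)) (\<phi> ` (U \<inter> (N \<inter> W)))"
      using chart_open[OF c] assms(1) N(1) by (intro chart_image_open[OF c]) auto
    then show "\<exists>T. openin (Euclidean_space (mdim M)) T \<and> y \<in> T \<and> T \<subseteq> \<phi> ` (U \<inter> W) \<and>
        Cinf_on (mdim M) T (\<lambda>y. f (inv_into U \<phi> y))"
      using smooth_on_in_chart[OF N(3) c] x N(2) by (intro exI[of _ "\<phi> ` (U \<inter> (N \<inter> W))"]) auto
  qed
qed

text \<open>One chart suffices to test smoothness, since the transition maps are smooth.\<close>

lemma smooth_on_chartI:
  assumes c: "(U, \<phi>) \<in> charts M" and W: "open W" "W \<subseteq> U"
    and f: "Cinf_on (mdim M) (\<phi> ` W) (\<lambda>y. f (inv_into U \<phi> y))"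
  shows "smooth_on M W f"
  unfolding smooth_on_def
proof safe
  fix V \<psi> assume d: "(V, \<psi>) \<in> charts M"
  let ?S = "\<psi> ` (V \<inter> W)" and ?F = "\<lambda>y. \<phi> (inv_into V \<psi> y)"
  have S: "openin (Euclidean_space (mdim M)) ?S"
    using chart_open[OF d] W by (intro chart_image_open[OF d]) auto
  have inv: "inv_into V \<psi> y \<in> W" if "y \<in> ?S" for y
    using chart_inverse_mem[OF d, of "V \<inter> W"] that by blast
  have "Cinf_on (mdim M) ?S (\<lambda>y. f (inv_into U \<phi> (?F y)))"
  proof (rule Cinf_on_compose[OF S chart_image_open[OF c W] _ _ f])
    show "?F y \<in> \<phi> ` W" if "y \<in> ?S" for y using inv[OF that] by simp
    show "Cinf_on (mdim M) ?S (\<lambda>y. ?F y i)" if "i < mdim M" for i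
    proof (rule Cinf_on_subset[OF _ S])
      show "Cinf_on (mdim M) (\<psi> ` (V \<inter> U)) (\<lambda>y. ?F y i)"
        using M c d that unfolding smooth_manifold_def by fast
    qed (use chart_open[OF c] chart_open[OF d] W(2) in \<open>auto intro!: chart_image_open[OF d]\<close>)
  qed
  then show "Cinf_on (mdim M) ?S (\<lambda>y. f (inv_into V \<psi> y))"
    using inv W(2) chart_inj[OF c] by (elim Cinf_on_cong[OF S, rotated]) (metis inv_into_f_f subsetD)
qed

text \<open>
  The sets \<open>N\<close> and \<open>- C\<close> form an open cover, and the extended function is smooth on each.
\<close>

lemma smooth_on_extend_by_zero:
  assumes "open W" "open N" "closed C" "C \<subseteq> N" "smooth_on M (N \<inter> W) f"
    and "\<And>x. x \<in> N - C \<Longrightarrow> f x = 0"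
  shows "smooth_on M W (\<lambda>x. if x \<in> N then f x else 0)"
proof (rule smooth_on_local[OF assms(1)])
  fix x assume "x \<in> W"
  show "\<exists>N'. open N' \<and> x \<in> N' \<and> smooth_on M (N' \<inter> W) (\<lambda>x. if x \<in> N then f x else 0)"
  proof (cases "x \<in> N")
    case True
    have "smooth_on M (N \<inter> W) (\<lambda>x. if x \<in> N then f x else 0)"
      using assms by (intro smooth_on_cong[OF _ _ assms(5)]) auto
    then show ?thesis using True assms by blast
  next
    case False
    have "smooth_on M (- C \<inter> W) (\<lambda>x. if x \<in> N then f x else 0)"
      using assms by (intro smooth_on_cong[OF _ _ smooth_on_const[of _ 0]]) auto
    then show ?thesis using False assms by blast
  qed
qed

text \<open>
  In a chart, a flat function of the squared distance to \<open>x\<close> lives in a small box.  The box is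
  compact, hence so is the corresponding subset of the manifold, which is then closed since the
  manifold is Hausdorff; this is what allows the extension by zero.
\<close>

lemma bump_function:
  assumes "open W" "x \<in> W"
  obtains \<beta> C where "\<beta> \<in> smooth_functions M" "\<beta> x = 1" "closed C" "C \<subseteq> W" "\<And>y. y \<notin> C \<Longrightarrow> \<beta> y = 0"
proof -
  obtain U \<phi> where c: "(U, \<phi>) \<in> charts M" "x \<in> U" by (rule chart_exists)
  define n N p where "n = mdim M" and "N = U \<inter> W" and "p = \<phi> x"
  have N: "open N" "N \<subseteq> U" "x \<in> N" using chart_open[OF c(1)] c(2) assms by (auto simp: N_def)
  have S: "openin (Euclidean_space n) (\<phi> ` N)" using chart_image_open[OF c(1) N(1,2)] by (simp add: n_def)
  obtain e where e: "e > 0"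
    "\<And>y. y \<in> topspace (Euclidean_space n) \<Longrightarrow> (\<And>i. i < n \<Longrightarrow> \<bar>y i - p i\<bar> < e) \<Longrightarrow> y \<in> \<phi> ` N"
    using openin_Euclidean_space_box[OF S, of p] N(3) by (auto simp: p_def)
  define K where "K = PiE UNIV (\<lambda>i. if i < n then {p i - e/2..p i + e/2} else {0})"
  have "compactin (powertop_real UNIV) K"
    unfolding K_def by (simp add: compactin_PiE)
  then have "compact K" by (simp add: euclidean_product_topology)
  have KN: "K \<subseteq> \<phi> ` N"
  proof
    fix y assume y: "y \<in> K"
    then have y': "y i \<in> (if i < n then {p i - e/2..p i + e/2} else {0})" for i
      by (simp add: K_def PiE_iff)
    have "\<bar>y i - p i\<bar> < e" if "i < n" for i using y'[of i] that e(1) by (auto simp: abs_if)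
    moreover have "y i = 0" if "i \<ge> n" for i using y'[of i] that by simp
    ultimately show "y \<in> \<phi> ` N" by (intro e(2)) (simp_all add: topspace_Euclidean_space)
  qed
  define C where "C = inv_into U \<phi> ` K"
  have "compact C" unfolding C_def
    using chart_inverse_continuous[OF c(1)] KN N(2) \<open>compact K\<close>
    by (intro compact_continuous_image continuous_on_subset[OF chart_inverse_continuous[OF c(1)]])
      auto
  then have "closed C" by (rule compact_imp_closed)
  have "C \<subseteq> N" unfolding C_def using chart_inverse_mem[OF c(1) N(2)] KN by blast
  define r where "r y = e^2/4 - (\<Sum>i<n. (y i - p i)^2)" for y :: "nat \<Rightarrow> real"
  define h where "h y = inverse (flat 1 (e^2/4)) * flat 1 (r (\<phi> y))" for y
  have "smooth_on M (N \<inter> UNIV) h"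
  proof -
    have "Ck_on n k (\<phi> ` N) r" for k
    proof -
      have "Ck_on n k (\<phi> ` N) (\<lambda>y. e^2/4 + (\<Sum>i<n. -1 * ((y i + - p i) * (y i + - p i))))"
        by (intro Ck_on_add[OF S] Ck_on_sum[OF S] Ck_on_mult[OF S] Ck_on_const[OF S] Ck_on_coordinate[OF S])
      then show ?thesis by (simp add: r_def[abs_def] power2_eq_square sum_negf)
    qed
    then have "Cinf_on n (\<phi> ` N) (\<lambda>y. inverse (flat 1 (e^2/4)) * flat 1 (r y))"
      unfolding Cinf_on_def by (intro allI Ck_on_mult[OF S] Ck_on_const[OF S] Ck_on_flat[OF S])
    then have "Cinf_on n (\<phi> ` N) (\<lambda>y. h (inv_into U \<phi> y))"
      using N(2) by (elim Cinf_on_cong[OF S, rotated]) (auto simp: h_def f_inv_into_f)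
    then show ?thesis using smooth_on_chartI[OF c(1) N(1,2)] by (simp add: n_def)
  qed
  moreover have "h y = 0" if "y \<in> N - C" for y
  proof (rule ccontr)
    assume "h y \<noteq> 0"
    then have "r (\<phi> y) > 0" by (auto simp: h_def flat_def split: if_splits)
    then have s: "(\<Sum>i<n. (\<phi> y i - p i)^2) < (e/2)^2" by (simp add: r_def power_divide)
    have close: "\<bar>\<phi> y i - p i\<bar> \<le> e/2" if "i < n" for i
    proof -
      have "(\<phi> y i - p i)^2 \<le> (\<Sum>i<n. (\<phi> y i - p i)^2)"
        using that by (intro member_le_sum) auto
      then have "\<bar>\<phi> y i - p i\<bar>^2 \<le> (e/2)^2" using s by simp
      then show ?thesis using e(1) by (intro power2_le_imp_le[of "\<bar>\<phi> y i - p i\<bar>"]) auto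
    qed
    have top: "\<phi> y \<in> topspace (Euclidean_space n)" using that openin_subset[OF S] by auto
    have "\<phi> y i \<in> (if i < n then {p i - e/2..p i + e/2} else {0})" for i
    proof (cases "i < n")
      case True
      then have "\<bar>\<phi> y i - p i\<bar> \<le> e / 2" by (rule close)
      then show ?thesis using True unfolding abs_le_iff by auto
    next
      case False
      then show ?thesis using top by (simp add: topspace_Euclidean_space)
    qed
    then have "\<phi> y \<in> K" by (simp add: K_def PiE_iff)
    then have "y \<in> C"
      using that N(2) chart_inj[OF c(1)] unfolding C_def by (metis DiffD1 image_eqI inv_into_f_f subsetD)
    then show False using that by simp
  qed
  ultimately have "smooth_on M UNIV (\<lambda>y. if y \<in> N then h y else 0)"
    using smooth_on_extend_by_zero[OF open_UNIV N(1) \<open>closed C\<close> \<open>C \<subseteq> N\<close>] by blast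
  moreover have "h x = 1" using e(1) by (simp add: h_def r_def p_def flat_def)
  ultimately show ?thesis
    using that[of "\<lambda>y. if y \<in> N then h y else 0" C] \<open>closed C\<close> \<open>C \<subseteq> N\<close> N(3) \<open>\<And>y. y \<in> N - C \<Longrightarrow> h y = 0\<close>
    by (auto simp: smooth_functions_def N_def)
qed

end

text \<open>
  Near a point of the source, \<open>\<tau>\<close> stays in one chart of the target; there the composite is
  that of the coordinate expressions of \<open>f\<close> and \<open>\<tau>\<close>.
\<close>

lemma smooth_on_compose_smooth_map:
  fixes M :: "'m::{t2_space, second_countable_topology} manifold"
    and M' :: "'n::{t2_space, second_countable_topology} manifold"
  assumes M: "smooth_manifold M" and M': "smooth_manifold M'" and \<tau>: "smooth_map M' M \<tau>"
    and W: "open W" and f: "smooth_on M W f"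
  shows "smooth_on M' (\<tau> -` W) (\<lambda>x. f (\<tau> x))"
proof (rule smooth_on_local[OF M'])
  have vim: "open (\<tau> -` V)" if "open V" for V
    using \<tau> that unfolding smooth_map_def by (simp add: open_vimage)
  show "open (\<tau> -` W)" by (rule vim[OF W])
  fix x assume x: "x \<in> \<tau> -` W"
  obtain V \<psi> where d: "(V, \<psi>) \<in> charts M" "\<tau> x \<in> V" by (rule chart_exists[OF M])
  have V: "open V" by (rule chart_open[OF M d(1)])
  have "smooth_on M' (\<tau> -` V \<inter> \<tau> -` W) (\<lambda>x. f (\<tau> x))"
    unfolding smooth_on_def
  proof safe
    fix U \<phi> assume c: "(U, \<phi>) \<in> charts M'"
    let ?S = "\<phi> ` (U \<inter> (\<tau> -` V \<inter> \<tau> -` W))" and ?F = "\<lambda>y. \<psi> (\<tau> (inv_into U \<phi> y))"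
    have S: "openin (Euclidean_space (mdim M')) ?S"
      using chart_open[OF M' c] vim[OF V] vim[OF W] by (intro chart_image_open[OF M' c]) auto
    have inv: "inv_into U \<phi> y \<in> \<tau> -` V \<inter> \<tau> -` W" if "y \<in> ?S" for y
      using chart_inverse_mem[OF M' c, of "U \<inter> (\<tau> -` V \<inter> \<tau> -` W)"] that by blast
    have T: "openin (Euclidean_space (mdim M)) (\<psi> ` (V \<inter> W))"
      using V W by (intro chart_image_open[OF M d(1)]) auto
    have "Cinf_on (mdim M') ?S (\<lambda>y. f (inv_into V \<psi> (?F y)))"
    proof (rule Cinf_on_compose[OF S T _ _ smooth_on_in_chart[OF M f d(1)]])
      show "?F y \<in> \<psi> ` (V \<inter> W)" if "y \<in> ?S" for y using inv[OF that] by simp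
      show "Cinf_on (mdim M') ?S (\<lambda>y. ?F y i)" if "i < mdim M" for i
      proof (rule Cinf_on_subset[OF _ S])
        have "smooth_on M' (\<tau> -` V) (\<lambda>x. \<psi> (\<tau> x) i)"
          using \<tau> d(1) that unfolding smooth_map_def by fast
        then show "Cinf_on (mdim M') (\<phi> ` (U \<inter> \<tau> -` V)) (\<lambda>y. ?F y i)"
          by (rule smooth_on_in_chart[OF M' _ c])
      qed (use chart_open[OF M' c] vim[OF V] in \<open>auto intro!: chart_image_open[OF M' c]\<close>)
    qed
    then show "Cinf_on (mdim M') ?S (\<lambda>y. f (\<tau> (inv_into U \<phi> y)))"
      using inv chart_inj[OF M d(1)] by (elim Cinf_on_cong[OF S, rotated]) (auto simp: inv_into_f_f)
  qed
  then show "\<exists>N. open N \<and> x \<in> N \<and> smooth_on M' (N \<inter> \<tau> -` W) (\<lambda>x. f (\<tau> x))"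
    using vim[OF V] d(2) by (intro exI[of _ "\<tau> -` V"]) simp
qed

section \<open>Sections of vector bundles\<close>

lemma basis_of_coeff_zero:
  assumes "basis_of W k b" "(\<Sum>i<k. c i *\<^sub>R b i) = 0" "i < k"
  shows "c i = 0"
proof -
  have inj: "inj_on b {..<k}" and ind: "independent (b ` {..<k})"
    using assms(1) by (auto simp: basis_of_def)
  define u where "u v = c (the_inv_into {..<k} b v)" for v
  have u: "u (b j) = c j" if "j < k" for j
    using the_inv_into_f_f[OF inj, of j] that by (simp add: u_def)
  have "(\<Sum>v\<in>b ` {..<k}. u v *\<^sub>R v) = 0"
    using assms(2) u by (simp add: sum.reindex[OF inj])
  then have "u (b i) = 0"
    using independentD[OF ind, of "b ` {..<k}" u "b i"] assms(3) by auto
  then show ?thesis using u[OF assms(3)] by simp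
qed

lemma basis_of_coeff_unique:
  assumes "basis_of W k b" "(\<Sum>i<k. c i *\<^sub>R b i) = (\<Sum>i<k. d i *\<^sub>R b i)" "i < k"
  shows "c i = d i"
  using basis_of_coeff_zero[OF assms(1) _ assms(3), of "\<lambda>i. c i - d i"] assms(2)
  by (simp add: scaleR_diff_left sum_subtractf)

lemma basis_of_subspace: "basis_of W k b \<Longrightarrow> subspace W"
  by (auto simp: basis_of_def)

lemma basis_of_mem: "basis_of W k b \<Longrightarrow> i < k \<Longrightarrow> b i \<in> W"
  using span_base[of "b i" "b ` {..<k}"] by (auto simp: basis_of_def)

lemma basis_of_expand:
  assumes "basis_of W k b" "w \<in> W"
  obtains c where "w = (\<Sum>i<k. c i *\<^sub>R b i)"
proof -
  have inj: "inj_on b {..<k}" and "w \<in> span (b ` {..<k})"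
    using assms by (auto simp: basis_of_def)
  then obtain u where "w = (\<Sum>v\<in>b ` {..<k}. u v *\<^sub>R v)"
    by (auto simp: span_finite)
  then show ?thesis using that[of "u \<circ> b"] by (simp add: sum.reindex[OF inj])
qed

locale smooth_vector_bundle =
  fixes M :: "'m::{t2_space, second_countable_topology} manifold"
    and E :: "('m, 'v::real_vector) vbundle"
  assumes manifold: "smooth_manifold M" and is_bundle: "vector_bundle M E"
begin

lemma frameD:
  assumes "(U, k, e) \<in> frames E"
  shows frame_open: "open U"
    and frame_basis: "x \<in> U \<Longrightarrow> basis_of (fibre E x) k (\<lambda>i. e i x)"
    and frame_smooth: "j < k \<Longrightarrow> smooth_section_on M E U (e j)"
  using is_bundle assms unfolding vector_bundle_def by fast+

lemma frame_exists:
  obtains U k e where "(U, k, e) \<in> frames E" "x \<in> U"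
proof -
  have "x \<in> (\<Union>(U, k, e)\<in>frames E. U)"
    using conjunct1[OF is_bundle[unfolded vector_bundle_def]] by simp
  then show ?thesis using that by fastforce
qed

lemma fibre_subspace: "subspace (fibre E x)"
proof -
  obtain U k e where "(U, k, e) \<in> frames E" "x \<in> U" by (rule frame_exists)
  then show ?thesis using frame_basis basis_of_subspace by metis
qed

lemma smooth_section_coeffs:
  assumes "smooth_section_on M E W s" "(U, k, e) \<in> frames E"
  shows "\<exists>c. (\<forall>i<k. smooth_on M (U \<inter> W) (c i)) \<and> (\<forall>x\<in>U \<inter> W. s x = (\<Sum>i<k. c i x *\<^sub>R e i x))"
  using assms unfolding smooth_section_on_def by fast

lemma smooth_section_onI:
  assumes "\<And>U k e. (U, k, e) \<in> frames E \<Longrightarrow> \<exists>c. (\<forall>i<k. smooth_on M (U \<inter> W) (c i)) \<and>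
    (\<forall>x\<in>U \<inter> W. s x = (\<Sum>i<k. c i x *\<^sub>R e i x))"
  shows "smooth_section_on M E W s"
  using assms unfolding smooth_section_on_def by fast

lemma smooth_section_in_fibre:
  assumes "smooth_section_on M E W s" "x \<in> W"
  shows "s x \<in> fibre E x"
proof -
  obtain U k e where U: "(U, k, e) \<in> frames E" "x \<in> U" by (rule frame_exists)
  obtain c where "s x = (\<Sum>i<k. c i x *\<^sub>R e i x)"
    using smooth_section_coeffs[OF assms(1) U(1)] U(2) assms(2) by auto
  then show ?thesis
    using basis_of_mem[OF frame_basis[OF U]] fibre_subspace
    by (auto intro!: subspace_sum subspace_scale)
qed

lemma sections_iff: "s \<in> sections M E \<longleftrightarrow> smooth_section_on M E UNIV s"
  using smooth_section_in_fibre by (auto simp: sections_def)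

lemma section_in_fibre: "s \<in> sections M E \<Longrightarrow> s x \<in> fibre E x"
  by (simp add: sections_def)

lemma smooth_section_cong:
  assumes "\<And>x. x \<in> W \<Longrightarrow> s x = t x" "smooth_section_on M E W s"
  shows "smooth_section_on M E W t"
proof (rule smooth_section_onI)
  fix U k e assume U: "(U, k, e) \<in> frames E"
  show "\<exists>c. (\<forall>i<k. smooth_on M (U \<inter> W) (c i)) \<and> (\<forall>x\<in>U \<inter> W. t x = (\<Sum>i<k. c i x *\<^sub>R e i x))"
    using smooth_section_coeffs[OF assms(2) U] assms(1) by auto
qed

lemma smooth_section_subset:
  assumes "open W" "open W'" "W' \<subseteq> W" "smooth_section_on M E W s"
  shows "smooth_section_on M E W' s"
proof (rule smooth_section_onI)
  fix U k e assume U: "(U, k, e) \<in> frames E"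
  obtain c where c: "\<And>i. i < k \<Longrightarrow> smooth_on M (U \<inter> W) (c i)"
    "\<And>x. x \<in> U \<Longrightarrow> x \<in> W \<Longrightarrow> s x = (\<Sum>i<k. c i x *\<^sub>R e i x)"
    using smooth_section_coeffs[OF assms(4) U] by auto
  have "smooth_on M (U \<inter> W') (c i)" if "i < k" for i
    using frame_open[OF U] assms(1-3) by (intro smooth_on_subset[OF manifold _ _ _ c(1)[OF that]]) auto
  then show "\<exists>c. (\<forall>i<k. smooth_on M (U \<inter> W') (c i)) \<and> (\<forall>x\<in>U \<inter> W'. s x = (\<Sum>i<k. c i x *\<^sub>R e i x))"
    using c(2) assms(3) by (intro exI[of _ c]) auto
qed

lemma smooth_section_zero: "open W \<Longrightarrow> smooth_section_on M E W (\<lambda>x. 0)"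
  by (intro smooth_section_onI exI[of _ "\<lambda>_ _. 0"]) (auto intro!: smooth_on_const[OF manifold] dest: frame_open)

lemma smooth_section_add:
  assumes "open W" "smooth_section_on M E W s" "smooth_section_on M E W t"
  shows "smooth_section_on M E W (\<lambda>x. s x + t x)"
proof (rule smooth_section_onI)
  fix U k e assume U: "(U, k, e) \<in> frames E"
  obtain c where c: "\<And>i. i < k \<Longrightarrow> smooth_on M (U \<inter> W) (c i)"
    "\<And>x. x \<in> U \<Longrightarrow> x \<in> W \<Longrightarrow> s x = (\<Sum>i<k. c i x *\<^sub>R e i x)"
    using smooth_section_coeffs[OF assms(2) U] by auto
  obtain d where d: "\<And>i. i < k \<Longrightarrow> smooth_on M (U \<inter> W) (d i)"
    "\<And>x. x \<in> U \<Longrightarrow> x \<in> W \<Longrightarrow> t x = (\<Sum>i<k. d i x *\<^sub>R e i x)"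
    using smooth_section_coeffs[OF assms(3) U] by auto
  show "\<exists>c. (\<forall>i<k. smooth_on M (U \<inter> W) (c i)) \<and> (\<forall>x\<in>U \<inter> W. s x + t x = (\<Sum>i<k. c i x *\<^sub>R e i x))"
    using c d frame_open[OF U] assms(1)
    by (intro exI[of _ "\<lambda>i x. c i x + d i x"])
      (auto simp: scaleR_add_left sum.distrib intro!: smooth_on_add[OF manifold])
qed

lemma smooth_section_scale:
  assumes "open W" "smooth_on M W f" "smooth_section_on M E W s"
  shows "smooth_section_on M E W (\<lambda>x. f x *\<^sub>R s x)"
proof (rule smooth_section_onI)
  fix U k e assume U: "(U, k, e) \<in> frames E"
  obtain c where c: "\<And>i. i < k \<Longrightarrow> smooth_on M (U \<inter> W) (c i)"
    "\<And>x. x \<in> U \<Longrightarrow> x \<in> W \<Longrightarrow> s x = (\<Sum>i<k. c i x *\<^sub>R e i x)"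
    using smooth_section_coeffs[OF assms(3) U] by auto
  have "smooth_on M (U \<inter> W) f"
    using frame_open[OF U] assms(1) by (intro smooth_on_subset[OF manifold _ _ _ assms(2)]) auto
  then show "\<exists>c. (\<forall>i<k. smooth_on M (U \<inter> W) (c i)) \<and> (\<forall>x\<in>U \<inter> W. f x *\<^sub>R s x = (\<Sum>i<k. c i x *\<^sub>R e i x))"
    using c frame_open[OF U] assms(1)
    by (intro exI[of _ "\<lambda>i x. f x * c i x"])
      (auto simp: scaleR_sum_right intro!: smooth_on_mult[OF manifold])
qed

lemma smooth_section_diff:
  assumes "open W" "smooth_section_on M E W s" "smooth_section_on M E W t"
  shows "smooth_section_on M E W (\<lambda>x. s x - t x)"
  using smooth_section_add[OF assms(1,2) smooth_section_scale[OF assms(1) smooth_on_const[OF manifold assms(1), of "-1"] assms(3)]]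
  by simp

text \<open>
  Smoothness of a section asks for coefficient functions on the whole of each frame domain.  Local
  ones fit together because coefficients with respect to a basis are unique.
\<close>

lemma smooth_section_local:
  assumes "open W" and loc: "\<And>x. x \<in> W \<Longrightarrow> \<exists>N. open N \<and> x \<in> N \<and> smooth_section_on M E (N \<inter> W) s"
  shows "smooth_section_on M E W s"
proof (rule smooth_section_onI)
  fix U k e assume U: "(U, k, e) \<in> frames E"
  define Q where "Q x N c \<longleftrightarrow> open N \<and> x \<in> N \<and> (\<forall>i<k. smooth_on M (U \<inter> (N \<inter> W)) (c i)) \<and>
      (\<forall>y. y \<in> U \<longrightarrow> y \<in> N \<longrightarrow> y \<in> W \<longrightarrow> s y = (\<Sum>i<k. c i y *\<^sub>R e i y))" for x N c
  have "\<exists>N c. Q x N c" if "x \<in> W" for x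
  proof -
    obtain N where N: "open N" "x \<in> N" "smooth_section_on M E (N \<inter> W) s" using loc[OF \<open>x \<in> W\<close>] by blast
    obtain c where "\<And>i. i < k \<Longrightarrow> smooth_on M (U \<inter> (N \<inter> W)) (c i)"
      "\<And>y. y \<in> U \<Longrightarrow> y \<in> N \<inter> W \<Longrightarrow> s y = (\<Sum>i<k. c i y *\<^sub>R e i y)"
      using smooth_section_coeffs[OF N(3) U] by auto
    then show ?thesis unfolding Q_def using N by (intro exI[of _ N] exI[of _ c]) auto
  qed
  then obtain N c where "\<And>x. x \<in> W \<Longrightarrow> Q x (N x) (c x)" by metis
  then have N: "\<And>x. x \<in> W \<Longrightarrow> open (N x)" "\<And>x. x \<in> W \<Longrightarrow> x \<in> N x"
    and c: "\<And>x i. x \<in> W \<Longrightarrow> i < k \<Longrightarrow> smooth_on M (U \<inter> (N x \<inter> W)) (c x i)"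
      "\<And>x y. x \<in> W \<Longrightarrow> y \<in> U \<Longrightarrow> y \<in> N x \<Longrightarrow> y \<in> W \<Longrightarrow> s y = (\<Sum>i<k. c x i y *\<^sub>R e i y)"
    unfolding Q_def by simp_all
  \<comment> \<open>uniqueness of coefficients makes the diagonal choice agree with every local one\<close>
  have diag: "c y i y = c x i y" if "x \<in> W" "y \<in> U" "y \<in> N x" "y \<in> W" "i < k" for x y i
    using c(2)[OF that(1-4)] c(2)[of y y] N(2) that frame_basis[OF U]
    by (intro basis_of_coeff_unique[OF frame_basis[OF U that(2)] _ that(5)]) simp
  have "smooth_on M (U \<inter> W) (\<lambda>y. c y i y)" if i: "i < k" for i
  proof (rule smooth_on_local[OF manifold])
    show "open (U \<inter> W)" using frame_open[OF U] assms(1) by blast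
    fix x assume x: "x \<in> U \<inter> W"
    have "smooth_on M (N x \<inter> (U \<inter> W)) (\<lambda>y. c y i y)"
    proof (rule smooth_on_cong[OF manifold])
      show "open (N x \<inter> (U \<inter> W))" using N x frame_open[OF U] assms(1) by auto
      show "smooth_on M (N x \<inter> (U \<inter> W)) (c x i)" using c(1)[OF _ i] x by (simp add: Int_left_commute)
    qed (use diag x i in auto)
    then show "\<exists>N. open N \<and> x \<in> N \<and> smooth_on M (N \<inter> (U \<inter> W)) (\<lambda>y. c y i y)"
      using N x by blast
  qed
  then show "\<exists>c. (\<forall>i<k. smooth_on M (U \<inter> W) (c i)) \<and> (\<forall>x\<in>U \<inter> W. s x = (\<Sum>i<k. c i x *\<^sub>R e i x))"
    using c(2) N(2) by (intro exI[of _ "\<lambda>i y. c y i y"]) auto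
qed

lemma smooth_section_extend_by_zero:
  assumes "open N" "closed C" "C \<subseteq> N" "smooth_section_on M E N s"
    and "\<And>x. x \<in> N - C \<Longrightarrow> s x = 0"
  shows "(\<lambda>x. if x \<in> N then s x else 0) \<in> sections M E"
  unfolding sections_iff
proof (rule smooth_section_local[OF open_UNIV])
  fix x :: 'm
  show "\<exists>N'. open N' \<and> x \<in> N' \<and> smooth_section_on M E (N' \<inter> UNIV) (\<lambda>x. if x \<in> N then s x else 0)"
  proof (cases "x \<in> N")
    case True
    have "smooth_section_on M E N (\<lambda>x. if x \<in> N then s x else 0)"
      using assms by (intro smooth_section_cong[OF _ assms(4)]) auto
    then show ?thesis using True assms by auto
  next
    case False
    have "smooth_section_on M E (- C) (\<lambda>x. if x \<in> N then s x else 0)"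
      using assms by (intro smooth_section_cong[OF _ smooth_section_zero]) auto
    then show ?thesis using False assms by (intro exI[of _ "- C"]) auto
  qed
qed

lemma smooth_functions_iff: "f \<in> smooth_functions M \<longleftrightarrow> smooth_on M UNIV f"
  by (simp add: smooth_functions_def)

lemma sections_add: "s \<in> sections M E \<Longrightarrow> t \<in> sections M E \<Longrightarrow> (\<lambda>x. s x + t x) \<in> sections M E"
  by (simp add: sections_iff smooth_section_add)

lemma sections_diff: "s \<in> sections M E \<Longrightarrow> t \<in> sections M E \<Longrightarrow> (\<lambda>x. s x - t x) \<in> sections M E"
  by (simp add: sections_iff smooth_section_diff)

lemma sections_scale:
  "f \<in> smooth_functions M \<Longrightarrow> s \<in> sections M E \<Longrightarrow> (\<lambda>x. f x *\<^sub>R s x) \<in> sections M E"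
  by (simp add: sections_iff smooth_functions_iff smooth_section_scale)

lemma sections_zero: "(\<lambda>x. 0) \<in> sections M E"
  by (simp add: sections_iff smooth_section_zero)

lemma sections_sum:
  "(\<And>i. i < k \<Longrightarrow> s i \<in> sections M E) \<Longrightarrow> (\<lambda>x. \<Sum>i<k. s i x) \<in> sections M E" for k :: nat
  by (induction k) (simp_all add: sections_zero sections_add)

lemma cut_off_frame_section:
  assumes U: "(U, k, e) \<in> frames E" and \<beta>: "\<beta> \<in> smooth_functions M"
    and C: "closed C" "C \<subseteq> U" "\<And>y. y \<notin> C \<Longrightarrow> \<beta> y = 0" and i: "i < k"
  shows "(\<lambda>y. if y \<in> U then \<beta> y *\<^sub>R e i y else 0) \<in> sections M E"
proof (rule smooth_section_extend_by_zero[OF frame_open[OF U] C(1,2)])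
  have "smooth_on M U \<beta>"
    using \<beta> smooth_on_subset[OF manifold open_UNIV frame_open[OF U]] by (simp add: smooth_functions_iff)
  then show "smooth_section_on M E U (\<lambda>y. \<beta> y *\<^sub>R e i y)"
    by (rule smooth_section_scale[OF frame_open[OF U] _ frame_smooth[OF U i]])
qed (simp add: C(3))

lemma section_through:
  assumes "v \<in> fibre E x"
  obtains s where "s \<in> sections M E" "s x = v"
proof -
  obtain U k e where U: "(U, k, e) \<in> frames E" "x \<in> U" by (rule frame_exists)
  obtain c where c: "v = (\<Sum>i<k. c i *\<^sub>R e i x)"
    using basis_of_expand[OF frame_basis[OF U] assms] .
  obtain \<beta> C where \<beta>: "\<beta> \<in> smooth_functions M" "\<beta> x = 1" "closed C" "C \<subseteq> U" "\<And>y. y \<notin> C \<Longrightarrow> \<beta> y = 0"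
    using bump_function[OF manifold frame_open[OF U(1)] U(2)] by metis
  have "(\<lambda>y. \<Sum>i<k. c i *\<^sub>R (if y \<in> U then \<beta> y *\<^sub>R e i y else 0)) \<in> sections M E"
    using cut_off_frame_section[OF U(1) \<beta>(1,3-5)]
    by (intro sections_sum sections_scale) (auto simp: smooth_functions_iff smooth_on_const[OF manifold])
  then show ?thesis using that c U(2) \<beta>(2) by simp
qed

text \<open>
  With a bump function \<open>\<beta>\<close> at \<open>x\<close> and frame coefficients \<open>c i\<close> of \<open>u\<close>, one has
  \<open>u = (1 - \<beta>\<^sup>2) u + (\<Sum>i. (\<beta> c i) (\<beta> e i))\<close>: of the two factors \<open>\<beta>\<close> one makes the
  coefficients global and the other the frame.  At \<open>x\<close> all coefficients vanish, as \<open>\<beta> x = 1\<close>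
  and \<open>u x = 0\<close>.
\<close>

lemma vanishing_section_decomposition:
  assumes u: "u \<in> sections M E" "u x = 0"
  obtains h k f s where "h \<in> smooth_functions M" "h x = 0"
    "\<And>i. i < k \<Longrightarrow> f i \<in> smooth_functions M" "\<And>i. i < k \<Longrightarrow> f i x = 0"
    "\<And>i. i < k \<Longrightarrow> s i \<in> sections M E"
    "u = (\<lambda>y. h y *\<^sub>R u y + (\<Sum>i<(k::nat). f i y *\<^sub>R s i y))"
proof -
  obtain U k e where U: "(U, k, e) \<in> frames E" "x \<in> U" by (rule frame_exists)
  obtain c where c: "\<And>i. i < k \<Longrightarrow> smooth_on M (U \<inter> UNIV) (c i)"
    and c': "\<And>y. y \<in> U \<Longrightarrow> y \<in> UNIV \<Longrightarrow> u y = (\<Sum>i<k. c i y *\<^sub>R e i y)"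
    using smooth_section_coeffs[OF u(1)[unfolded sections_iff] U(1)] by auto
  obtain \<beta> C where \<beta>: "\<beta> \<in> smooth_functions M" "\<beta> x = 1" "closed C" "C \<subseteq> U" "\<And>y. y \<notin> C \<Longrightarrow> \<beta> y = 0"
    using bump_function[OF manifold frame_open[OF U(1)] U(2)] by metis
  define f where "f i y = (if y \<in> U then \<beta> y * c i y else 0)" for i y
  define s where "s i y = (if y \<in> U then \<beta> y *\<^sub>R e i y else 0)" for i y
  define h where "h y = 1 - \<beta> y * \<beta> y" for y
  have s: "s i \<in> sections M E" if "i < k" for i
    unfolding s_def using cut_off_frame_section[OF U(1) \<beta>(1,3-5) that] .
  have f: "f i \<in> smooth_functions M" if "i < k" for i
  proof -
    have "smooth_on M U \<beta>"
      using \<beta>(1) smooth_on_subset[OF manifold open_UNIV frame_open[OF U(1)]] by (simp add: smooth_functions_iff)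
    then have "smooth_on M (U \<inter> UNIV) (\<lambda>y. \<beta> y * c i y)"
      using c[OF that] frame_open[OF U(1)] by (simp add: smooth_on_mult[OF manifold])
    then show ?thesis
      unfolding smooth_functions_iff f_def using \<beta>(3-5) frame_open[OF U(1)]
      by (intro smooth_on_extend_by_zero[OF manifold open_UNIV]) auto
  qed
  have h: "h \<in> smooth_functions M"
    using \<beta>(1) unfolding smooth_functions_iff h_def
    by (intro smooth_on_diff[OF manifold] smooth_on_mult[OF manifold] smooth_on_const[OF manifold] open_UNIV)
  have c0: "c i x = 0" if "i < k" for i
    using basis_of_coeff_zero[OF frame_basis[OF U] _ that, of "\<lambda>i. c i x"] c'[OF U(2)] u(2) by simp
  have "u y = h y *\<^sub>R u y + (\<Sum>i<k. f i y *\<^sub>R s i y)" for y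
  proof (cases "y \<in> U")
    case True
    have "(\<Sum>i<k. f i y *\<^sub>R s i y) = (\<beta> y * \<beta> y) *\<^sub>R u y"
      using True c'[OF True] by (simp add: f_def s_def scaleR_sum_right mult_ac)
    then show ?thesis by (simp add: h_def algebra_simps)
  next
    case False
    then have "\<beta> y = 0" using \<beta>(4,5) by blast
    then show ?thesis using False by (simp add: h_def f_def)
  qed
  then have "u = (\<lambda>y. h y *\<^sub>R u y + (\<Sum>i<k. f i y *\<^sub>R s i y))" by blast
  then show ?thesis
    using that[of h k f s] h f s c0 \<beta>(2) by (simp add: h_def f_def)
qed

text \<open>
  If \<open>w\<close> vanishes at \<open>x\<close>, each term in the decomposition of \<open>w\<close> carries a coefficient that
  vanishes there, and linearity pulls the coefficients out.
\<close>

lemma tensorial_operator_pointwise: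
  fixes T :: "('m \<Rightarrow> 'v) \<Rightarrow> 'm \<Rightarrow> 'w::real_vector"
  assumes add: "\<And>s t. s \<in> sections M E \<Longrightarrow> t \<in> sections M E \<Longrightarrow> T (\<lambda>y. s y + t y) x = T s x + T t x"
    and scale: "\<And>f s. f \<in> smooth_functions M \<Longrightarrow> s \<in> sections M E \<Longrightarrow> T (\<lambda>y. f y *\<^sub>R s y) x = f x *\<^sub>R T s x"
    and uv: "u \<in> sections M E" "v \<in> sections M E" "u x = v x"
  shows "T u x = T v x"
proof -
  have const: "(\<lambda>y. r) \<in> smooth_functions M" for r
    by (simp add: smooth_functions_iff smooth_on_const[OF manifold])
  have zero: "T (\<lambda>y. 0) x = 0"
    using scale[OF const[of 0] sections_zero] by simp
  have sum: "T (\<lambda>y. \<Sum>i<k. s i y) x = (\<Sum>i<k. T (s i) x)"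
    if "\<And>i. i < k \<Longrightarrow> s i \<in> sections M E" for k :: nat and s
    using that by (induction k) (simp_all add: zero add sections_sum)
  have vanish: "T w x = 0" if w: "w \<in> sections M E" "w x = 0" for w
  proof -
    obtain h k f s where d: "h \<in> smooth_functions M" "h x = 0"
      "\<And>i. i < k \<Longrightarrow> f i \<in> smooth_functions M" "\<And>i. i < k \<Longrightarrow> f i x = 0"
      "\<And>i. i < k \<Longrightarrow> s i \<in> sections M E"
      "w = (\<lambda>y. h y *\<^sub>R w y + (\<Sum>i<(k::nat). f i y *\<^sub>R s i y))"
      using vanishing_section_decomposition[OF w] by blast
    have "T w x = T (\<lambda>y. h y *\<^sub>R w y + (\<Sum>i<k. f i y *\<^sub>R s i y)) x"
      using d(6) by simp
    also have "\<dots> = T (\<lambda>y. h y *\<^sub>R w y) x + T (\<lambda>y. \<Sum>i<k. f i y *\<^sub>R s i y) x"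
      by (intro add sections_scale sections_sum d(1,3,5) w(1))
    also have "\<dots> = h x *\<^sub>R T w x + (\<Sum>i<k. f i x *\<^sub>R T (s i) x)"
      using d(1,3,5) w(1) by (simp add: scale sum sections_scale)
    finally show ?thesis using d(2,4) by simp
  qed
  have m: "(\<lambda>y. (-1) *\<^sub>R v y) \<in> sections M E" by (rule sections_scale[OF const uv(2)])
  have "T (\<lambda>y. u y + (-1) *\<^sub>R v y) x = T u x - T v x"
    using add[OF uv(1) m] scale[OF const uv(2), of "-1"] by simp
  moreover have "T (\<lambda>y. u y + (-1) *\<^sub>R v y) x = 0"
    by (rule vanish[OF sections_add[OF uv(1) m]]) (simp add: uv(3))
  ultimately show ?thesis by simp
qed

end

section \<open>Orthogonal projection in a Courant algebroid\<close>

lemma courant_algebroidD: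
  assumes "courant_algebroid M E A"
  shows courant_vector_bundle: "vector_bundle M E"
    and courant_fibre_metric: "fibre_metric M E (pairing A)"
    and courant_anchor: "anchor_map M E (anchor A)"
    and bracket_section: "u \<in> sections M E \<Longrightarrow> v \<in> sections M E \<Longrightarrow> bracket A u v \<in> sections M E"
    and bracket_add_left: "u \<in> sections M E \<Longrightarrow> v \<in> sections M E \<Longrightarrow> w \<in> sections M E \<Longrightarrow>
      bracket A (\<lambda>x. u x + v x) w = (\<lambda>x. bracket A u w x + bracket A v w x)"
    and bracket_scale_right: "u \<in> sections M E \<Longrightarrow> v \<in> sections M E \<Longrightarrow> f \<in> smooth_functions M \<Longrightarrow>
      bracket A u (\<lambda>x. f x *\<^sub>R v x) = (\<lambda>x. f x *\<^sub>R bracket A u v x + act A u f x *\<^sub>R v x)"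
    and bracket_symmetric_part: "u \<in> sections M E \<Longrightarrow> v \<in> sections M E \<Longrightarrow>
      (\<lambda>x. bracket A u v x + bracket A v u x) = d_E E A (pair A u v)"
proof -
  note axioms = assms[unfolded courant_algebroid_def]
  show "vector_bundle M E" "fibre_metric M E (pairing A)" "anchor_map M E (anchor A)"
    by (insert axioms, elim conjE, assumption)+
  have closed: "\<forall>u\<in>sections M E. \<forall>v\<in>sections M E. bracket A u v \<in> sections M E"
    and add: "\<forall>u\<in>sections M E. \<forall>v\<in>sections M E. \<forall>w\<in>sections M E.
        bracket A (\<lambda>x. u x + v x) w = (\<lambda>x. bracket A u w x + bracket A v w x) \<and>
        bracket A w (\<lambda>x. u x + v x) = (\<lambda>x. bracket A w u x + bracket A w v x)"
    and scale: "\<forall>u\<in>sections M E. \<forall>v\<in>sections M E. \<forall>f\<in>smooth_functions M.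
        bracket A u (\<lambda>x. f x *\<^sub>R v x) = (\<lambda>x. f x *\<^sub>R bracket A u v x + act A u f x *\<^sub>R v x)"
    and symm: "\<forall>u\<in>sections M E. \<forall>v\<in>sections M E.
        (\<lambda>x. bracket A u v x + bracket A v u x) = d_E E A (pair A u v)"
    by (insert axioms, elim conjE, assumption)+
  show "bracket A u v \<in> sections M E" if "u \<in> sections M E" "v \<in> sections M E"
    using bspec[OF bspec[OF closed that(1)] that(2)] .
  show "bracket A (\<lambda>x. u x + v x) w = (\<lambda>x. bracket A u w x + bracket A v w x)"
    if "u \<in> sections M E" "v \<in> sections M E" "w \<in> sections M E"
    using bspec[OF bspec[OF bspec[OF add that(1)] that(2)] that(3)] by (rule conjunct1)
  show "bracket A u (\<lambda>x. f x *\<^sub>R v x) = (\<lambda>x. f x *\<^sub>R bracket A u v x + act A u f x *\<^sub>R v x)"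
    if "u \<in> sections M E" "v \<in> sections M E" "f \<in> smooth_functions M"
    using bspec[OF bspec[OF bspec[OF scale that(1)] that(2)] that(3)] .
  show "(\<lambda>x. bracket A u v x + bracket A v u x) = d_E E A (pair A u v)"
    if "u \<in> sections M E" "v \<in> sections M E"
    using bspec[OF bspec[OF symm that(1)] that(2)] .
qed

lemma fibre_endo_eqI:
  assumes "u \<in> sub_sections M E V" "u x = v"
    and "\<And>u'. u' \<in> sub_sections M E V \<Longrightarrow> u' x = v \<Longrightarrow> T u' x = T u x"
  shows "fibre_endo M E V T x v = T u x"
  unfolding fibre_endo_def
proof (rule someI2[of _ u])
  show "u \<in> sub_sections M E V \<and> u x = v" using assms(1,2) ..
  show "T u' x = T u x" if "u' \<in> sub_sections M E V \<and> u' x = v" for u'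
    using assms(3) that by blast
qed

text \<open>
  The common setting for the base and for its pullback.  Positivity on \<open>V\<close> makes \<open>V\<close>
  nondegenerate and drives the Gram--Schmidt process.
\<close>

locale courant_positive_subbundle =
  fixes M :: "'m::{t2_space, second_countable_topology} manifold"
    and E :: "('m, 'v::real_vector) vbundle"
    and A :: "('m, 'v) ca_structure"
    and V :: "'m \<Rightarrow> 'v set"
  assumes manifold': "smooth_manifold M"
    and courant: "courant_algebroid M E A"
    and sub: "subbundle M E V"
    and positive: "u \<in> V x \<Longrightarrow> u \<noteq> 0 \<Longrightarrow> pairing A x u u > 0"
begin

sublocale smooth_vector_bundle M E
  by unfold_locales (fact manifold' courant_vector_bundle[OF courant])+

lemma
  assumes "u \<in> fibre E x" "v \<in> fibre E x"
  shows pairing_sym: "pairing A x u v = pairing A x v u"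
    and pairing_add_left: "w \<in> fibre E x \<Longrightarrow> pairing A x (u + v) w = pairing A x u w + pairing A x v w"
    and pairing_scale_left: "pairing A x (c *\<^sub>R u) v = c * pairing A x u v"
proof -
  note metric = courant_fibre_metric[OF courant, unfolded fibre_metric_def]
  show "pairing A x u v = pairing A x v u"
    by (rule conjunct1[OF metric, rule_format, OF assms])
  show "pairing A x (u + v) w = pairing A x u w + pairing A x v w" if "w \<in> fibre E x"
    by (rule conjunct1[OF conjunct2[OF metric], rule_format, OF assms that])
  show "pairing A x (c *\<^sub>R u) v = c * pairing A x u v"
    by (rule conjunct1[OF conjunct2[OF conjunct2[OF metric]], rule_format, OF assms])
qed

lemma pairing_nondegenerate:
  "u \<in> fibre E x \<Longrightarrow> (\<And>v. v \<in> fibre E x \<Longrightarrow> pairing A x u v = 0) \<Longrightarrow> u = 0"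
  using conjunct1[OF conjunct2[OF conjunct2[OF conjunct2[OF
      courant_fibre_metric[OF courant, unfolded fibre_metric_def]]]]]
  by simp

lemma pairing_frame_smooth:
  "(U, k, e) \<in> frames E \<Longrightarrow> i < k \<Longrightarrow> j < k \<Longrightarrow> smooth_on M U (\<lambda>x. pairing A x (e i x) (e j x))"
  using conjunct2[OF conjunct2[OF conjunct2[OF conjunct2[OF
      courant_fibre_metric[OF courant, unfolded fibre_metric_def]]]]]
  by fast

lemmas fibre_closed = subspace_add[OF fibre_subspace] subspace_scale[OF fibre_subspace]
  subspace_diff[OF fibre_subspace] subspace_0[OF fibre_subspace]

lemma pairing_zero_left: "v \<in> fibre E x \<Longrightarrow> pairing A x 0 v = 0"
  using pairing_scale_left[of 0 x v 0] fibre_closed by simp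

lemma pairing_add_right:
  "u \<in> fibre E x \<Longrightarrow> v \<in> fibre E x \<Longrightarrow> w \<in> fibre E x \<Longrightarrow> pairing A x w (u + v) = pairing A x w u + pairing A x w v"
  using pairing_sym pairing_add_left fibre_closed(1) by metis

lemma pairing_scale_right:
  "u \<in> fibre E x \<Longrightarrow> v \<in> fibre E x \<Longrightarrow> pairing A x v (c *\<^sub>R u) = c * pairing A x v u"
  using pairing_sym pairing_scale_left fibre_closed(2) by metis

lemma pairing_zero_right: "v \<in> fibre E x \<Longrightarrow> pairing A x v 0 = 0"
  using pairing_scale_right[of 0 x v 0] fibre_closed by simp

lemma pairing_diff_right:
  "u \<in> fibre E x \<Longrightarrow> v \<in> fibre E x \<Longrightarrow> w \<in> fibre E x \<Longrightarrow> pairing A x w (u - v) = pairing A x w u - pairing A x w v"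
  using pairing_add_right[of u x "(-1) *\<^sub>R v" w] pairing_scale_right[of v x w "-1"] fibre_closed(2)[of v x "-1"]
  by simp

lemma pairing_diff_left:
  "u \<in> fibre E x \<Longrightarrow> v \<in> fibre E x \<Longrightarrow> w \<in> fibre E x \<Longrightarrow> pairing A x (u - v) w = pairing A x u w - pairing A x v w"
  using pairing_add_left[of u x "(-1) *\<^sub>R v" w] pairing_scale_left[of v x w "-1"] fibre_closed(2)[of v x "-1"]
  by simp

lemma pairing_sum_left:
  assumes "v \<in> fibre E x" "\<And>i. i < k \<Longrightarrow> b i \<in> fibre E x"
  shows "pairing A x (\<Sum>i<(k::nat). c i *\<^sub>R b i) v = (\<Sum>i<k. c i * pairing A x (b i) v)"
  using assms(2)
proof (induction k)
  case 0
  then show ?case using pairing_zero_left[OF assms(1)] by simp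
next
  case (Suc k)
  have "(\<Sum>i<k. c i *\<^sub>R b i) \<in> fibre E x"
    using Suc.prems by (intro subspace_sum[OF fibre_subspace] fibre_closed(2)) auto
  then show ?case
    using Suc assms(1) by (simp add: pairing_add_left pairing_scale_left fibre_closed(2))
qed

text \<open>
  In a frame the pairing of two sections is a polynomial in their coefficients and the pairings of
  frame vectors.
\<close>

lemma pairing_smooth:
  assumes "open W" "smooth_section_on M E W s" "smooth_section_on M E W t"
  shows "smooth_on M W (\<lambda>x. pairing A x (s x) (t x))"
proof (rule smooth_on_local[OF manifold assms(1)])
  fix x assume "x \<in> W"
  obtain U k e where U: "(U, k, e) \<in> frames E" "x \<in> U" by (rule frame_exists)
  obtain c where c: "\<And>i. i < k \<Longrightarrow> smooth_on M (U \<inter> W) (c i)"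
    "\<And>x. x \<in> U \<Longrightarrow> x \<in> W \<Longrightarrow> s x = (\<Sum>i<k. c i x *\<^sub>R e i x)"
    using smooth_section_coeffs[OF assms(2) U(1)] by auto
  obtain d where d: "\<And>i. i < k \<Longrightarrow> smooth_on M (U \<inter> W) (d i)"
    "\<And>x. x \<in> U \<Longrightarrow> x \<in> W \<Longrightarrow> t x = (\<Sum>i<k. d i x *\<^sub>R e i x)"
    using smooth_section_coeffs[OF assms(3) U(1)] by auto
  have op: "open (U \<inter> W)" using frame_open[OF U(1)] assms(1) by blast
  have eU: "e i y \<in> fibre E y" if "i < k" "y \<in> U" for i y
    using basis_of_mem[OF frame_basis[OF U(1) that(2)] that(1)] .
  have sm: "smooth_on M (U \<inter> W) (\<lambda>y. \<Sum>i<k. c i y * (\<Sum>j<k. d j y * pairing A y (e i y) (e j y)))"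
    using c(1) d(1) smooth_on_subset[OF manifold frame_open[OF U(1)] op _ pairing_frame_smooth[OF U(1)]]
    by (intro smooth_on_sum[OF manifold op] smooth_on_mult[OF manifold op]) auto
  have eq: "(\<Sum>i<k. c i y * (\<Sum>j<k. d j y * pairing A y (e i y) (e j y))) = pairing A y (s y) (t y)"
    if "y \<in> U \<inter> W" for y
  proof -
    have y: "y \<in> U" "y \<in> W" using that by auto
    have ty: "t y \<in> fibre E y" by (rule smooth_section_in_fibre[OF assms(3) y(2)])
    have "pairing A y (e i y) (t y) = (\<Sum>j<k. d j y * pairing A y (e i y) (e j y))" if "i < k" for i
    proof -
      have "pairing A y (e i y) (t y) = pairing A y (t y) (e i y)"
        by (rule pairing_sym[OF eU[OF that y(1)] ty])
      also have "\<dots> = (\<Sum>j<k. d j y * pairing A y (e j y) (e i y))"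
        unfolding d(2)[OF y] by (rule pairing_sum_left) (use eU y that in auto)
      also have "\<dots> = (\<Sum>j<k. d j y * pairing A y (e i y) (e j y))"
        by (intro sum.cong refl) (metis eU y(1) that pairing_sym lessThan_iff)
      finally show ?thesis .
    qed
    moreover have "pairing A y (s y) (t y) = (\<Sum>i<k. c i y * pairing A y (e i y) (t y))"
      unfolding c(2)[OF y] by (rule pairing_sum_left[OF ty]) (use eU y in auto)
    ultimately show ?thesis by simp
  qed
  have "smooth_on M (U \<inter> W) (\<lambda>x. pairing A x (s x) (t x))"
    by (rule smooth_on_cong[OF manifold op eq sm])
  then show "\<exists>N. open N \<and> x \<in> N \<and> smooth_on M (N \<inter> W) (\<lambda>x. pairing A x (s x) (t x))"
    using U frame_open by blast
qed

lemma V_subspace: "subspace (V x)" and V_fibre: "v \<in> V x \<Longrightarrow> v \<in> fibre E x"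
  using sub unfolding subbundle_def by blast+

lemma pairing_span_zero:
  assumes "v \<in> span B" "B \<subseteq> fibre E x" "w \<in> fibre E x" "\<And>b. b \<in> B \<Longrightarrow> pairing A x b w = 0"
  shows "pairing A x v w = 0"
proof -
  have "v \<in> fibre E x \<and> pairing A x v w = 0"
    using assms(1)
  proof (induction rule: span_induct)
    case base
    show ?case
      using assms(3) fibre_closed
      by (auto simp: subspace_def pairing_zero_left pairing_add_left pairing_scale_left)
  qed (use assms in auto)
  then show ?thesis ..
qed

text \<open>
  Smoothness of the orthogonal projection: Gram--Schmidt turns a local frame into an orthogonal
  one, one vector at a time.
\<close>

lemma local_orthogonal_projection:
  assumes U: "open U" and b: "\<And>j. j < k \<Longrightarrow> smooth_section_on M E U (b j)"
    and basis: "\<And>y. y \<in> U \<Longrightarrow> basis_of (V y) k (\<lambda>j. b j y)"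
  shows "m \<le> k \<Longrightarrow> smooth_section_on M E U s \<Longrightarrow> \<exists>p. smooth_section_on M E U p \<and>
    (\<forall>y\<in>U. p y \<in> span ((\<lambda>j. b j y) ` {..<m}) \<and> (\<forall>j<m. pairing A y (b j y) (s y - p y) = 0))"
proof (induction m arbitrary: s)
  case 0
  then show ?case using smooth_section_zero[OF U] by (intro exI[of _ "\<lambda>y. 0"]) auto
next
  case (Suc m)
  then have m: "m < k" by simp
  let ?B = "\<lambda>y. (\<lambda>j. b j y) ` {..<m}"
  obtain q where q: "smooth_section_on M E U q" "\<And>y. y \<in> U \<Longrightarrow> q y \<in> span (?B y)"
    "\<And>y j. y \<in> U \<Longrightarrow> j < m \<Longrightarrow> pairing A y (b j y) (b m y - q y) = 0"
    using Suc.IH[OF _ b[OF m]] m by auto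
  obtain p where p: "smooth_section_on M E U p" "\<And>y. y \<in> U \<Longrightarrow> p y \<in> span (?B y)"
    "\<And>y j. y \<in> U \<Longrightarrow> j < m \<Longrightarrow> pairing A y (b j y) (s y - p y) = 0"
    using Suc.IH[OF _ Suc.prems(2)] m by auto
  \<comment> \<open>\<open>w\<close> is the next orthogonal vector, and \<open>c\<close> makes \<open>s - p - c w\<close> orthogonal to it\<close>
  define w where "w y = b m y - q y" for y
  define c where "c y = pairing A y (w y) (s y - p y) * inverse (pairing A y (w y) (w y))" for y
  have w: "smooth_section_on M E U w" unfolding w_def by (rule smooth_section_diff[OF U b[OF m] q(1)])
  have bf: "b j y \<in> fibre E y" if "j < k" "y \<in> U" for j y
    by (rule smooth_section_in_fibre[OF b[OF that(1)] that(2)])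
  have bV: "b j y \<in> V y" if "j < k" "y \<in> U" for j y
    using basis_of_mem[OF basis[OF that(2)] that(1)] .
  have BF: "?B y \<subseteq> fibre E y" if "y \<in> U" for y using bf m that by auto
  have qV: "q y \<in> V y" if "y \<in> U" for y
  proof -
    have "span (?B y) \<subseteq> V y" using bV m that by (intro span_minimal V_subspace) auto
    then show ?thesis using q(2)[OF that] by blast
  qed
  have wpos: "pairing A y (w y) (w y) > 0" if y: "y \<in> U" for y
  proof (rule positive)
    show "w y \<in> V y" unfolding w_def using bV[OF m y] qV[OF y] by (rule subspace_diff[OF V_subspace])
    have inj: "inj_on (\<lambda>j. b j y) {..<k}" and ind: "independent ((\<lambda>j. b j y) ` {..<k})"
      using basis[OF y] by (auto simp: basis_of_def)
    have "b m y \<notin> span ((\<lambda>j. b j y) ` {..<k} - {b m y})"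
      using ind m unfolding dependent_def by blast
    moreover have "?B y \<subseteq> (\<lambda>j. b j y) ` {..<k} - {b m y}"
      using inj m by (auto simp: inj_on_def)
    ultimately have "b m y \<notin> span (?B y)" using span_mono by blast
    then show "w y \<noteq> 0" using q(2)[OF y] by (auto simp: w_def)
  qed
  have sp: "smooth_section_on M E U (\<lambda>y. s y - p y)" by (rule smooth_section_diff[OF U Suc.prems(2) p(1)])
  have c: "smooth_on M U c"
    unfolding c_def using wpos
    by (intro smooth_on_mult[OF manifold U] smooth_on_inverse[OF manifold U] pairing_smooth[OF U] w sp) fastforce
  let ?p = "\<lambda>y. p y + c y *\<^sub>R w y"
  have "smooth_section_on M E U ?p"
    by (rule smooth_section_add[OF U p(1) smooth_section_scale[OF U c w]])
  moreover have "?p y \<in> span ((\<lambda>j. b j y) ` {..<Suc m})" if y: "y \<in> U" for y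
  proof -
    have "span (?B y) \<subseteq> span ((\<lambda>j. b j y) ` {..<Suc m})" by (intro span_mono) auto
    moreover have "b m y \<in> span ((\<lambda>j. b j y) ` {..<Suc m})" by (intro span_base) auto
    ultimately show ?thesis
      unfolding w_def using p(2)[OF y] q(2)[OF y] by (intro span_add span_scale span_diff) auto
  qed
  moreover have "pairing A y (b j y) (s y - ?p y) = 0" if y: "y \<in> U" and j: "j < Suc m" for y j
  proof -
    have F: "s y - p y \<in> fibre E y" "w y \<in> fibre E y" "q y \<in> fibre E y" "b j y \<in> fibre E y"
      using smooth_section_in_fibre[OF sp y] smooth_section_in_fibre[OF w y]
        smooth_section_in_fibre[OF q(1) y] bf[of j y] j m y by auto
    have expand: "pairing A y v (s y - ?p y) = pairing A y v (s y - p y) - c y * pairing A y v (w y)"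
      if "v \<in> fibre E y" for v
      using pairing_diff_right[OF F(1) fibre_closed(2)[OF F(2), of "c y"] that]
        pairing_scale_right[OF F(2) that, of "c y"] by (simp add: diff_diff_eq)
    show ?thesis
    proof (cases "j < m")
      case True
      then show ?thesis using expand[OF F(4)] p(3)[OF y True] q(3)[OF y True] by (simp add: w_def)
    next
      case False
      then have jm: "j = m" using j by simp
      have "pairing A y (q y) (s y - p y) = 0" "pairing A y (q y) (w y) = 0"
        using pairing_span_zero[OF q(2)[OF y] BF[OF y]] F p(3)[OF y] q(3)[OF y] by (auto simp: w_def)
      then have "pairing A y (b m y) (s y - p y) = pairing A y (w y) (s y - p y)"
        "pairing A y (b m y) (w y) = pairing A y (w y) (w y)"
        using pairing_add_left[OF F(2,3)] F(1,2) by (simp_all add: w_def)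
      then show ?thesis using expand[OF F(4)] wpos[OF y] by (simp add: jm c_def)
    qed
  qed
  ultimately show ?case by blast
qed

lemma perp_iff: "w \<in> perp E A V x \<longleftrightarrow> w \<in> fibre E x \<and> (\<forall>v\<in>V x. pairing A x v w = 0)"
  by (simp add: perp_def)

lemma oproj_eqI:
  assumes "v \<in> V x" "s x - v \<in> perp E A V x"
  shows "oproj E A V s x = v"
  unfolding oproj_def
proof (rule the_equality)
  show "v \<in> V x \<and> s x - v \<in> perp E A V x" using assms by blast
  fix v' assume v': "v' \<in> V x \<and> s x - v' \<in> perp E A V x"
  have d: "v' - v \<in> V x" using v' assms V_subspace subspace_diff by blast
  have "pairing A x (v' - v) ((s x - v) - (s x - v')) = 0"
    using v' assms d by (subst pairing_diff_right) (auto simp: perp_iff V_fibre)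
  then show "v' = v" using positive[OF d] by auto
qed

lemma orthogonal_projection_section:
  assumes s: "s \<in> sections M E"
  shows oproj_section: "oproj E A V s \<in> sections M E"
    and oproj_mem: "oproj E A V s x \<in> V x"
    and oproj_perp: "s x - oproj E A V s x \<in> perp E A V x"
proof -
  have loc: "\<exists>U p. open U \<and> x \<in> U \<and> smooth_section_on M E U p \<and>
      (\<forall>y\<in>U. p y \<in> V y \<and> s y - p y \<in> perp E A V y)" for x
  proof -
    obtain U k b where U: "open U" "x \<in> U" and b: "\<And>j. j < k \<Longrightarrow> smooth_section_on M E U (b j)"
      and basis: "\<And>y. y \<in> U \<Longrightarrow> basis_of (V y) k (\<lambda>j. b j y)"
      using sub unfolding subbundle_def by meson
    have sU: "smooth_section_on M E U s"
      using s smooth_section_subset[OF open_UNIV U(1)] by (simp add: sections_iff)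
    obtain p where p: "smooth_section_on M E U p" "\<And>y. y \<in> U \<Longrightarrow> p y \<in> span ((\<lambda>j. b j y) ` {..<k})"
      "\<And>y j. y \<in> U \<Longrightarrow> j < k \<Longrightarrow> pairing A y (b j y) (s y - p y) = 0"
      using local_orthogonal_projection[OF U(1) b basis order_refl sU] by auto
    have span: "span ((\<lambda>j. b j y) ` {..<k}) = V y" if "y \<in> U" for y
      using basis[OF that] by (simp add: basis_of_def)
    have "s y - p y \<in> perp E A V y" if y: "y \<in> U" for y
      unfolding perp_iff
    proof (intro conjI ballI)
      show f: "s y - p y \<in> fibre E y"
        using section_in_fibre[OF s] smooth_section_in_fibre[OF p(1) y] by (rule fibre_closed(3))
      fix v assume "v \<in> V y"
      then have "v \<in> span ((\<lambda>j. b j y) ` {..<k})" using span[OF y] by simp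
      then show "pairing A y v (s y - p y) = 0"
        by (rule pairing_span_zero[OF _ _ f]) (use p(3)[OF y] smooth_section_in_fibre[OF b y] in auto)
    qed
    then show ?thesis using U p(1,2) span by blast
  qed
  show "oproj E A V s x \<in> V x" "s x - oproj E A V s x \<in> perp E A V x"
    using loc[of x] oproj_eqI by metis+
  show "oproj E A V s \<in> sections M E"
    unfolding sections_iff
  proof (rule smooth_section_local[OF open_UNIV])
    fix x
    obtain U p where U: "open U" "x \<in> U" "smooth_section_on M E U p"
      "\<And>y. y \<in> U \<Longrightarrow> p y \<in> V y \<and> s y - p y \<in> perp E A V y" using loc[of x] by blast
    have "smooth_section_on M E U (oproj E A V s)"
      using oproj_eqI U(4) by (intro smooth_section_cong[OF _ U(3)]) metis
    then show "\<exists>N. open N \<and> x \<in> N \<and> smooth_section_on M E (N \<inter> UNIV) (oproj E A V s)"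
      using U(1,2) by auto
  qed
qed

lemma oproj_on_V: "s x \<in> V x \<Longrightarrow> oproj E A V s x = s x"
  by (rule oproj_eqI) (auto simp: perp_iff fibre_closed V_fibre pairing_zero_right)

lemma perp_subspace: "subspace (perp E A V x)"
  unfolding subspace_def
  by (auto simp: perp_iff fibre_closed V_fibre pairing_zero_right pairing_add_right pairing_scale_right)

lemma oproj_add:
  assumes "s \<in> sections M E" "t \<in> sections M E"
  shows "oproj E A V (\<lambda>y. s y + t y) x = oproj E A V s x + oproj E A V t x"
proof (rule oproj_eqI)
  show "oproj E A V s x + oproj E A V t x \<in> V x"
    by (intro subspace_add[OF V_subspace] oproj_mem assms)
  show "s x + t x - (oproj E A V s x + oproj E A V t x) \<in> perp E A V x"
    using subspace_add[OF perp_subspace oproj_perp[OF assms(1)] oproj_perp[OF assms(2)]]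
    by (simp add: algebra_simps)
qed

lemma oproj_scale:
  assumes "s \<in> sections M E"
  shows "oproj E A V (\<lambda>y. f y *\<^sub>R s y) x = f x *\<^sub>R oproj E A V s x"
proof (rule oproj_eqI)
  show "f x *\<^sub>R oproj E A V s x \<in> V x"
    by (intro subspace_scale[OF V_subspace] oproj_mem assms)
  show "f x *\<^sub>R s x - f x *\<^sub>R oproj E A V s x \<in> perp E A V x"
    using subspace_scale[OF perp_subspace oproj_perp[OF assms]] by (simp add: scaleR_diff_right)
qed

text \<open>
  Vectors of the fibre split into a part in \<open>V\<close> and a part orthogonal to it; therefore a vector in
  the complement that is orthogonal to the complement is orthogonal to everything, and vanishes.
  This yields uniqueness of the projection to the complement.
\<close>

lemma oproj_perp_eq:
  assumes s: "s \<in> sections M E"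
  shows "oproj E A (perp E A V) s x = s x - oproj E A V s x"
  unfolding oproj_def[of E A "perp E A V"]
proof (rule the_equality)
  have V: "oproj E A V s x \<in> perp E A (perp E A V) x"
    using oproj_mem[OF s, of x] V_fibre by (auto simp: perp_def[of E A "perp E A V"] perp_iff pairing_sym)
  then show "s x - oproj E A V s x \<in> perp E A V x \<and> s x - (s x - oproj E A V s x) \<in> perp E A (perp E A V) x"
    using oproj_perp[OF s] by simp
  fix w assume w: "w \<in> perp E A V x \<and> s x - w \<in> perp E A (perp E A V) x"
  let ?z = "w - (s x - oproj E A V s x)"
  have z: "?z \<in> perp E A V x" by (rule subspace_diff[OF perp_subspace conjunct1[OF w] oproj_perp[OF s]])
  have zz: "pairing A x v ?z = 0" if v: "v \<in> perp E A V x" for v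
  proof -
    have "pairing A x v (s x - w) = 0" "pairing A x v (oproj E A V s x) = 0"
      using w V v by (auto simp: perp_def[of E A "perp E A V"])
    then have "pairing A x v (oproj E A V s x - (s x - w)) = 0"
      using pairing_diff_right[of "oproj E A V s x" x "s x - w" v] w v V
      by (simp add: perp_def[of E A "perp E A V"] perp_iff)
    moreover have "?z = oproj E A V s x - (s x - w)" by simp
    ultimately show ?thesis by metis
  qed
  have "?z = 0"
  proof (rule pairing_nondegenerate)
    show zf: "?z \<in> fibre E x" using z by (simp add: perp_iff)
    fix u assume u: "u \<in> fibre E x"
    obtain t where t: "t \<in> sections M E" "t x = u" using section_through[OF u] .
    have "pairing A x (oproj E A V t x) ?z = 0" using z oproj_mem[OF t(1)] by (simp add: perp_iff)
    moreover have "pairing A x (u - oproj E A V t x) ?z = 0" using zz oproj_perp[OF t(1), of x] t(2) by simp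
    ultimately have "pairing A x u ?z = 0"
      using pairing_diff_left[OF u V_fibre[OF oproj_mem[OF t(1)]] zf] by simp
    then show "pairing A x ?z u = 0" using pairing_sym[OF zf u] by simp
  qed
  then show "w = s x - oproj E A V s x" by simp
qed

lemma oproj_perp_section:
  assumes "s \<in> sections M E"
  shows "oproj E A (perp E A V) s \<in> sections M E"
proof -
  have "oproj E A (perp E A V) s = (\<lambda>x. s x - oproj E A V s x)"
    by (rule ext) (rule oproj_perp_eq[OF assms])
  then show ?thesis using sections_diff[OF assms oproj_section[OF assms]] by simp
qed

lemma oproj_perp_mem: "s \<in> sections M E \<Longrightarrow> oproj E A (perp E A V) s x \<in> perp E A V x"
  using oproj_perp_eq oproj_perp by simp

lemma oproj_perp_add:
  "s \<in> sections M E \<Longrightarrow> t \<in> sections M E \<Longrightarrow>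
    oproj E A (perp E A V) (\<lambda>y. s y + t y) x = oproj E A (perp E A V) s x + oproj E A (perp E A V) t x"
  by (simp add: oproj_perp_eq oproj_add sections_add)

lemma differential_zero: "d_E E A (\<lambda>x. 0) x = 0"
  unfolding d_E_def
proof (rule the_equality)
  have 0: "(\<lambda>y. 0::real) \<in> smooth_functions M"
    by (simp add: smooth_functions_iff smooth_on_const[OF manifold])
  have anchor0: "anchor A x u (\<lambda>y. 0) = 0" if "u \<in> fibre E x" for u
  proof -
    have "anchor A x u \<in> tangent_space M x"
      by (rule conjunct1[OF courant_anchor[OF courant, unfolded anchor_map_def], rule_format, OF that])
    note derivation = this[unfolded tangent_space_def mem_Collect_eq]
    from bspec[OF spec[OF conjunct1[OF conjunct2[OF conjunct2[OF derivation]]], of 0] 0]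
    show ?thesis by simp
  qed
  show "0 \<in> fibre E x \<and> (\<forall>u\<in>fibre E x. pairing A x u 0 = anchor A x u (\<lambda>x. 0))"
    using anchor0 by (simp add: fibre_closed pairing_zero_right)
  fix w assume w: "w \<in> fibre E x \<and> (\<forall>u\<in>fibre E x. pairing A x u w = anchor A x u (\<lambda>x. 0))"
  show "w = 0" by (rule pairing_nondegenerate) (use w anchor0 pairing_sym in auto)
qed

text \<open>
  The symmetric part of the bracket is \<open>d\<^sub>E\<close> of the pairing, so the bracket of orthogonal
  sections is antisymmetric.  The Leibniz rule then passes from the second argument to the first
  without the usual extra term in \<open>d\<^sub>E f\<close>.
\<close>

lemma bracket_scale_left_orthogonal:
  assumes u: "u \<in> sections M E" and v: "v \<in> sections M E" and f: "f \<in> smooth_functions M"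
    and orth: "\<And>x. pairing A x (u x) (v x) = 0"
  shows "bracket A (\<lambda>y. f y *\<^sub>R u y) v x = f x *\<^sub>R bracket A u v x - act A v f x *\<^sub>R u x"
proof -
  have anti: "bracket A w v x = - bracket A v w x" if w: "w \<in> sections M E" "\<And>x. pairing A x (w x) (v x) = 0" for w
  proof -
    have "pair A w v = (\<lambda>x. 0)" using w(2) by (simp add: pair_def)
    then have "bracket A w v x + bracket A v w x = 0"
      using fun_cong[OF bracket_symmetric_part[OF courant w(1) v], of x] differential_zero by simp
    then show ?thesis by (simp add: eq_neg_iff_add_eq_0)
  qed
  have "pairing A x (f x *\<^sub>R u x) (v x) = 0" for x
    using orth pairing_scale_left[OF section_in_fibre[OF u] section_in_fibre[OF v]] by simp
  then have "bracket A (\<lambda>y. f y *\<^sub>R u y) v x = - bracket A v (\<lambda>y. f y *\<^sub>R u y) x"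
    by (intro anti sections_scale f u)
  also have "\<dots> = f x *\<^sub>R (- bracket A v u x) - act A v f x *\<^sub>R u x"
    using bracket_scale_right[OF courant v u f] by simp
  finally show ?thesis using anti[OF u orth] by simp
qed

end

section \<open>The operator under the trace\<close>

context courant_positive_subbundle
begin

lemma sub_section_through:
  assumes "v \<in> V x"
  obtains u where "u \<in> sub_sections M E V" "u x = v"
proof -
  obtain s where s: "s \<in> sections M E" "s x = v" using section_through[OF V_fibre[OF assms]] .
  show ?thesis
    using that[of "oproj E A V s"] oproj_section[OF s(1)] oproj_mem[OF s(1)] oproj_on_V[of s x] s(2) assms
    by (simp add: sub_sections_def)
qed

lemma V_has_basis: "\<exists>B. independent B \<and> span B = V x"
proof -
  obtain U k b where "x \<in> U" "\<And>y. y \<in> U \<Longrightarrow> basis_of (V y) k (\<lambda>j. b j y)"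
    using sub unfolding subbundle_def by meson
  then have "basis_of (V x) k (\<lambda>j. b j x)" by blast
  then show ?thesis unfolding basis_of_def by blast
qed

end

locale ricci_arguments = courant_positive_subbundle +
  fixes a b
  assumes a: "a \<in> sub_sections M E V" and b: "b \<in> sub_sections M E (perp E A V)"
begin

definition
  "ricci_operator u = oproj E A V (bracket A (oproj E A (perp E A V) (bracket A u b)) a)"

lemma a_section: "a \<in> sections M E" and a_mem: "a x \<in> V x"
  and b_section: "b \<in> sections M E" and b_mem: "b x \<in> perp E A V x"
  using a b by (simp_all add: sub_sections_def)

lemma ricci_operator_add:
  assumes u: "u \<in> sections M E" and v: "v \<in> sections M E"
  shows "ricci_operator (\<lambda>y. u y + v y) x = ricci_operator u x + ricci_operator v x"
proof -
  let ?N = "\<lambda>u. oproj E A (perp E A V) (bracket A u b)"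
  have ub: "bracket A u b \<in> sections M E" and vb: "bracket A v b \<in> sections M E"
    using bracket_section[OF courant] u v b_section by blast+
  have N: "?N (\<lambda>y. u y + v y) = (\<lambda>y. ?N u y + ?N v y)"
    unfolding bracket_add_left[OF courant u v b_section] by (rule ext) (rule oproj_perp_add[OF ub vb])
  have "bracket A (?N u) a \<in> sections M E" "bracket A (?N v) a \<in> sections M E"
    using bracket_section[OF courant _ a_section] oproj_perp_section ub vb by blast+
  then show ?thesis
    unfolding ricci_operator_def N
      bracket_add_left[OF courant oproj_perp_section[OF ub] oproj_perp_section[OF vb] a_section]
    by (rule oproj_add)
qed

lemma ricci_operator_scale:
  assumes u: "u \<in> sub_sections M E V" and f: "f \<in> smooth_functions M"
  shows "ricci_operator (\<lambda>y. f y *\<^sub>R u y) x = f x *\<^sub>R ricci_operator u x"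
proof -
  have us: "u \<in> sections M E" and uV: "\<And>y. u y \<in> V y" using u by (auto simp: sub_sections_def)
  define w where "w = bracket A u b"
  define z where "z = bracket A (oproj E A (perp E A V) w) a"
  have w: "w \<in> sections M E" unfolding w_def by (rule bracket_section[OF courant us b_section])
  have Nw: "oproj E A (perp E A V) w \<in> sections M E" by (rule oproj_perp_section[OF w])
  have z: "z \<in> sections M E" unfolding z_def by (rule bracket_section[OF courant Nw a_section])
  have fu: "(\<lambda>y. f y *\<^sub>R u y) \<in> sections M E" by (rule sections_scale[OF f us])
  have "pairing A y (u y) (b y) = 0" for y using uV b_mem by (simp add: perp_iff)
  then have first: "bracket A (\<lambda>y. f y *\<^sub>R u y) b y = f y *\<^sub>R w y - act A b f y *\<^sub>R u y" for y
    unfolding w_def by (rule bracket_scale_left_orthogonal[OF us b_section f])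
  \<comment> \<open>the anchor term of the inner bracket lies in \<open>V\<close>, so the projection to the complement removes it\<close>
  have N: "oproj E A (perp E A V) (bracket A (\<lambda>y. f y *\<^sub>R u y) b) = (\<lambda>y. f y *\<^sub>R oproj E A (perp E A V) w y)"
  proof
    fix y
    have "oproj E A V (bracket A (\<lambda>y. f y *\<^sub>R u y) b) y = f y *\<^sub>R oproj E A V w y - act A b f y *\<^sub>R u y"
    proof (rule oproj_eqI)
      show "f y *\<^sub>R oproj E A V w y - act A b f y *\<^sub>R u y \<in> V y"
        by (intro subspace_diff[OF V_subspace] subspace_scale[OF V_subspace] uV oproj_mem[OF w])
      show "bracket A (\<lambda>y. f y *\<^sub>R u y) b y - (f y *\<^sub>R oproj E A V w y - act A b f y *\<^sub>R u y) \<in> perp E A V y"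
        using subspace_scale[OF perp_subspace oproj_perp[OF w], of "f y" y]
        by (simp add: first scaleR_diff_right)
    qed
    then show "oproj E A (perp E A V) (bracket A (\<lambda>y. f y *\<^sub>R u y) b) y = f y *\<^sub>R oproj E A (perp E A V) w y"
      by (simp add: oproj_perp_eq bracket_section[OF courant fu b_section] w first scaleR_diff_right)
  qed
  have "pairing A y (oproj E A (perp E A V) w y) (a y) = 0" for y
    using oproj_perp_mem[OF w, of y] a_mem[of y] V_fibre[OF a_mem, of y]
    by (simp add: perp_iff pairing_sym)
  then have second: "bracket A (\<lambda>y. f y *\<^sub>R oproj E A (perp E A V) w y) a y
      = f y *\<^sub>R z y - act A a f y *\<^sub>R oproj E A (perp E A V) w y" for y
    unfolding z_def by (rule bracket_scale_left_orthogonal[OF Nw a_section f])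
  \<comment> \<open>the anchor term of the outer bracket lies in the complement and is removed in turn\<close>
  show ?thesis
    unfolding ricci_operator_def N
    unfolding w_def[symmetric] z_def[symmetric]
  proof (rule oproj_eqI)
    show "f x *\<^sub>R oproj E A V z x \<in> V x"
      by (intro subspace_scale[OF V_subspace] oproj_mem[OF z])
    have "f x *\<^sub>R (z x - oproj E A V z x) - act A a f x *\<^sub>R oproj E A (perp E A V) w x \<in> perp E A V x"
      by (intro subspace_diff[OF perp_subspace] subspace_scale[OF perp_subspace] oproj_perp[OF z] oproj_perp_mem[OF w])
    then show "bracket A (\<lambda>y. f y *\<^sub>R oproj E A (perp E A V) w y) a x - f x *\<^sub>R oproj E A V z x \<in> perp E A V x"
      by (simp add: second scaleR_diff_right algebra_simps)
  qed
qed

text \<open>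
  The operator is linear over smooth functions on sections of \<open>V\<close> only.  Composed with the
  projection to \<open>V\<close> it becomes so on all sections of the bundle, where the pointwise criterion
  applies.
\<close>

lemma ricci_operator_tensorial:
  assumes u: "u \<in> sub_sections M E V" and v: "v \<in> sub_sections M E V" and uv: "u x = v x"
  shows "ricci_operator u x = ricci_operator v x"
proof -
  have proj: "oproj E A V s \<in> sub_sections M E V" if "s \<in> sections M E" for s
    using oproj_section[OF that] oproj_mem[OF that] by (simp add: sub_sections_def)
  have fixed: "oproj E A V s = s" if "s \<in> sub_sections M E V" for s
    using that oproj_on_V by (auto simp: sub_sections_def)
  have "ricci_operator (oproj E A V u) x = ricci_operator (oproj E A V v) x"
  proof (rule tensorial_operator_pointwise[where T = "\<lambda>s. ricci_operator (oproj E A V s)"])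
    fix s t assume st: "s \<in> sections M E" "t \<in> sections M E"
    have "oproj E A V (\<lambda>y. s y + t y) = (\<lambda>y. oproj E A V s y + oproj E A V t y)"
      by (rule ext) (rule oproj_add[OF st])
    then show "ricci_operator (oproj E A V (\<lambda>y. s y + t y)) x
        = ricci_operator (oproj E A V s) x + ricci_operator (oproj E A V t) x"
      using ricci_operator_add[OF oproj_section[OF st(1)] oproj_section[OF st(2)]] by simp
  next
    fix f s assume f: "f \<in> smooth_functions M" and s: "s \<in> sections M E"
    have "oproj E A V (\<lambda>y. f y *\<^sub>R s y) = (\<lambda>y. f y *\<^sub>R oproj E A V s y)"
      by (rule ext) (rule oproj_scale[OF s])
    then show "ricci_operator (oproj E A V (\<lambda>y. f y *\<^sub>R s y)) x = f x *\<^sub>R ricci_operator (oproj E A V s) x"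
      using ricci_operator_scale[OF proj[OF s] f] by simp
  qed (use u v uv in \<open>simp_all add: sub_sections_def\<close>)
  then show ?thesis by (simp add: fixed u v)
qed

lemma fibre_endo_ricci_operator:
  assumes "u \<in> sub_sections M E V"
  shows "fibre_endo M E V ricci_operator x (u x) = ricci_operator u x"
  by (rule fibre_endo_eqI[OF assms refl]) (rule ricci_operator_tensorial[OF _ assms])

end

text \<open>
  The basis chosen for the trace depends on \<open>W\<close> alone, so both sides use the same one.
\<close>

lemma trace_on_cong:
  assumes "\<exists>B. independent B \<and> span B = W" "\<And>v. v \<in> W \<Longrightarrow> F v = G v"
  shows "trace_on W F = trace_on W G"
proof -
  define B where "B = (SOME B. independent B \<and> span B = W)"
  have "independent B \<and> span B = W" unfolding B_def by (rule someI_ex[OF assms(1)])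
  then have "F v = G v" if "v \<in> B" for v using that assms(2) span_base by blast
  then show ?thesis unfolding trace_on_def Let_def B_def[symmetric] by simp
qed

section \<open>Pullbacks\<close>

text \<open>
  The coefficients in the pulled-back frame are the pulled-back coefficients.
\<close>

lemma pullback_smooth_section:
  fixes M :: "'m::{t2_space, second_countable_topology} manifold"
    and M' :: "'n::{t2_space, second_countable_topology} manifold"
  assumes M: "smooth_manifold M" and M': "smooth_manifold M'" and \<tau>: "smooth_map M' M \<tau>"
    and E: "vector_bundle M E" and W: "open W" and s: "smooth_section_on M E W s"
  shows "smooth_section_on M' (pullback_bundle \<tau> E) (\<tau> -` W) (s \<circ> \<tau>)"
  unfolding smooth_section_on_def
proof safe
  interpret smooth_vector_bundle M E by unfold_locales (fact M E)+
  fix U' k e' assume "(U', k, e') \<in> frames (pullback_bundle \<tau> E)"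
  then obtain U e where U: "(U, k, e) \<in> frames E" "U' = \<tau> -` U" "e' = (\<lambda>i. e i \<circ> \<tau>)"
    by (auto simp: pullback_bundle_def)
  obtain c where c: "\<And>i. i < k \<Longrightarrow> smooth_on M (U \<inter> W) (c i)"
    "\<And>x. x \<in> U \<Longrightarrow> x \<in> W \<Longrightarrow> s x = (\<Sum>i<k. c i x *\<^sub>R e i x)"
    using smooth_section_coeffs[OF s U(1)] by auto
  have "smooth_on M' (\<tau> -` U \<inter> \<tau> -` W) (\<lambda>x. c i (\<tau> x))" if "i < k" for i
    using smooth_on_compose_smooth_map[OF M M' \<tau> _ c(1)[OF that]] frame_open[OF U(1)] W
    by (simp add: open_Int)
  then show "\<exists>c. (\<forall>i<k. smooth_on M' (U' \<inter> \<tau> -` W) (c i)) \<and>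
      (\<forall>x\<in>U' \<inter> \<tau> -` W. (s \<circ> \<tau>) x = (\<Sum>i<k. c i x *\<^sub>R e' i x))"
    using c(2) U by (intro exI[of _ "\<lambda>i x. c i (\<tau> x)"]) auto
qed

lemma perp_pullback:
  assumes "\<And>x u v. u \<in> fibre E (\<tau> x) \<Longrightarrow> v \<in> fibre E (\<tau> x) \<Longrightarrow> pairing A' x u v = pairing A (\<tau> x) u v"
    and "\<And>x. V x \<subseteq> fibre E x"
  shows "perp (pullback_bundle \<tau> E) A' (V \<circ> \<tau>) = perp E A V \<circ> \<tau>"
proof
  fix x
  have "(\<forall>v\<in>V (\<tau> x). pairing A' x v w = 0) \<longleftrightarrow> (\<forall>v\<in>V (\<tau> x). pairing A (\<tau> x) v w = 0)"
    if "w \<in> fibre E (\<tau> x)" for w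
    using assms that by (metis subsetD)
  then show "perp (pullback_bundle \<tau> E) A' (V \<circ> \<tau>) x = (perp E A V \<circ> \<tau>) x"
    by (auto simp: perp_def pullback_bundle_def)
qed

lemma oproj_pullback:
  assumes "\<And>x u v. u \<in> fibre E (\<tau> x) \<Longrightarrow> v \<in> fibre E (\<tau> x) \<Longrightarrow> pairing A' x u v = pairing A (\<tau> x) u v"
    and "\<And>x. V x \<subseteq> fibre E x"
  shows "oproj (pullback_bundle \<tau> E) A' (V \<circ> \<tau>) (w \<circ> \<tau>) = oproj E A V w \<circ> \<tau>"
  by (simp add: oproj_def perp_pullback[OF assms] fun_eq_iff)

lemma ca_pullbackD:
  assumes "ca_pullback M' M \<tau> E A A'"
  shows ca_pullback_courant: "courant_algebroid M' (pullback_bundle \<tau> E) A'"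
    and ca_pullback_pair: "u \<in> sections M E \<Longrightarrow> v \<in> sections M E \<Longrightarrow> pair A' (u \<circ> \<tau>) (v \<circ> \<tau>) = pair A u v \<circ> \<tau>"
    and ca_pullback_bracket: "u \<in> sections M E \<Longrightarrow> v \<in> sections M E \<Longrightarrow>
      bracket A' (u \<circ> \<tau>) (v \<circ> \<tau>) = bracket A u v \<circ> \<tau>"
    and ca_pullback_anchor: "u \<in> sections M E \<Longrightarrow>
      pushforward M \<tau> (anchor A' x (u (\<tau> x))) = anchor A (\<tau> x) (u (\<tau> x))"
  using assms unfolding ca_pullback_def by simp_all

text \<open>
  The assumption on the pairing concerns sections; it reaches single vectors by extending these to
  global sections.
\<close>

lemma ca_pullback_pairing:
  fixes M :: "'m::{t2_space, second_countable_topology} manifold"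
  assumes M: "smooth_manifold M" and E: "vector_bundle M E" and pb: "ca_pullback M' M \<tau> E A A'"
    and uv: "u \<in> fibre E (\<tau> x)" "v \<in> fibre E (\<tau> x)"
  shows "pairing A' x u v = pairing A (\<tau> x) u v"
proof -
  interpret smooth_vector_bundle M E by unfold_locales (fact M E)+
  obtain s where s: "s \<in> sections M E" "s (\<tau> x) = u" using section_through[OF uv(1)] .
  obtain t where t: "t \<in> sections M E" "t (\<tau> x) = v" using section_through[OF uv(2)] .
  show ?thesis
    using fun_cong[OF ca_pullback_pair[OF pb s(1) t(1)], of x] s(2) t(2) by (simp add: pair_def)
qed

text \<open>
  Local frames of \<open>V\<close> pull back to local frames, so everything proved for the base also holds for
  the pullback.
\<close>

lemma pullback_positive_subbundle:
  fixes M :: "'m::{t2_space, second_countable_topology} manifold"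
    and M' :: "'n::{t2_space, second_countable_topology} manifold"
  assumes base: "courant_positive_subbundle M E A V" and M': "smooth_manifold M'"
    and \<tau>: "smooth_map M' M \<tau>" and pb: "ca_pullback M' M \<tau> E A A'"
  shows "courant_positive_subbundle M' (pullback_bundle \<tau> E) A' (V \<circ> \<tau>)"
proof
  interpret courant_positive_subbundle M E A V by (rule base)
  show "smooth_manifold M'" by (rule M')
  show "courant_algebroid M' (pullback_bundle \<tau> E) A'" by (rule ca_pullback_courant[OF pb])
  show "pairing A' x u u > 0" if "u \<in> (V \<circ> \<tau>) x" "u \<noteq> 0" for u x
    using that positive[of u "\<tau> x"] V_fibre[of u "\<tau> x"]
      ca_pullback_pairing[OF manifold is_bundle pb, of u x u] by simp
  show "subbundle M' (pullback_bundle \<tau> E) (V \<circ> \<tau>)"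
    unfolding subbundle_def
  proof (intro conjI allI)
    fix x
    show "subspace ((V \<circ> \<tau>) x)" using V_subspace by simp
    show "(V \<circ> \<tau>) x \<subseteq> fibre (pullback_bundle \<tau> E) x" using V_fibre by (auto simp: pullback_bundle_def)
    obtain U k b where U: "open U" "\<tau> x \<in> U" "\<And>j. j < k \<Longrightarrow> smooth_section_on M E U (b j)"
      "\<And>y. y \<in> U \<Longrightarrow> basis_of (V y) k (\<lambda>j. b j y)"
      using sub unfolding subbundle_def by meson
    have "open (\<tau> -` U)" using \<tau> U(1) unfolding smooth_map_def by (simp add: open_vimage)
    moreover have "smooth_section_on M' (pullback_bundle \<tau> E) (\<tau> -` U) (b j \<circ> \<tau>)" if "j < k" for j
      by (rule pullback_smooth_section[OF manifold M' \<tau> is_bundle U(1) U(3)[OF that]])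
    ultimately show "\<exists>U k b. open U \<and> x \<in> U \<and>
        (\<forall>j<k. smooth_section_on M' (pullback_bundle \<tau> E) U (b j)) \<and>
        (\<forall>y\<in>U. basis_of ((V \<circ> \<tau>) y) k (\<lambda>j. b j y))"
      using U(2,4) by (intro exI[of _ "\<tau> -` U"] exI[of _ k] exI[of _ "\<lambda>j. b j \<circ> \<tau>"]) simp
  qed
qed

theorem theorem5p6:
  fixes M :: "'m::{t2_space, second_countable_topology} manifold"
    and M' :: "'n::{t2_space, second_countable_topology} manifold"
    and E :: "('m, 'v::real_vector) vbundle"
    and A :: "('m, 'v) ca_structure"
    and A' :: "('n, 'v) ca_structure"
    and Vp :: "'m \<Rightarrow> 'v set"
    and dv :: "('m \<Rightarrow> 'v) \<Rightarrow> 'm \<Rightarrow> real"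
    and dv' :: "('n \<Rightarrow> 'v) \<Rightarrow> 'n \<Rightarrow> real"
    and \<tau> :: "'n \<Rightarrow> 'm"
    and a b :: "'m \<Rightarrow> 'v"
  assumes "smooth_manifold M"
    and "smooth_manifold M'"
    and "courant_algebroid M E A"
    and "generalized_metric M E A Vp"
    and "divergence M E A dv"
    and "smooth_map M' M \<tau>"
    and "ca_pullback M' M \<tau> E A A'"
    and "is_pullback_divergence M' M \<tau> E A' dv dv'"
    and "a \<in> sub_sections M E Vp"
    and "b \<in> sub_sections M E (perp E A Vp)"
  shows "GRic M' (pullback_bundle \<tau> E) A' (Vp \<circ> \<tau>) dv' (a \<circ> \<tau>) (b \<circ> \<tau>)
       = GRic M E A Vp dv a b \<circ> \<tau>"
proof -
  let ?E' = "pullback_bundle \<tau> E" and ?V' = "Vp \<circ> \<tau>"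
  have base: "courant_positive_subbundle M E A Vp"
    using assms(1,3,4) by unfold_locales (auto simp: generalized_metric_def generalized_pseudometric_def)
  interpret base: ricci_arguments M E A Vp a b
    using base assms(9,10) by (simp add: ricci_arguments_def ricci_arguments_axioms_def)
  note pb = assms(7)
  interpret pull: courant_positive_subbundle M' ?E' A' ?V'
    by (rule pullback_positive_subbundle[OF base assms(2,6) pb])
  have pairing: "pairing A' x u v = pairing A (\<tau> x) u v"
    if "u \<in> fibre E (\<tau> x)" "v \<in> fibre E (\<tau> x)" for x u v
    by (rule ca_pullback_pairing[OF assms(1) base.is_bundle pb that])
  have Vp: "Vp x \<subseteq> fibre E x" for x using base.V_fibre by blast
  have perp: "perp ?E' A' ?V' = perp E A Vp \<circ> \<tau>"
    by (rule perp_pullback[OF pairing Vp])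
  have proj: "oproj ?E' A' ?V' (w \<circ> \<tau>) = oproj E A Vp w \<circ> \<tau>" for w
    by (rule oproj_pullback[OF pairing Vp])
  have proj_perp: "oproj ?E' A' (perp E A Vp \<circ> \<tau>) (w \<circ> \<tau>) = oproj E A (perp E A Vp) w \<circ> \<tau>" for w
    by (rule oproj_pullback[OF pairing]) (auto simp: perp_def)
  have sections: "s \<circ> \<tau> \<in> sections M' ?E'" if "s \<in> sections M E" for s
    using pullback_smooth_section[OF assms(1,2,6) base.is_bundle open_UNIV, of s] that
    by (simp add: pull.sections_iff base.sections_iff)
  have sub_sections: "s \<circ> \<tau> \<in> sub_sections M' ?E' (V \<circ> \<tau>)" if "s \<in> sub_sections M E V" for s V
    using that sections by (simp add: sub_sections_def)
  interpret pull: ricci_arguments M' ?E' A' ?V' "a \<circ> \<tau>" "b \<circ> \<tau>"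
    using sub_sections[OF assms(9)] sub_sections[OF assms(10)] by unfold_locales (simp_all add: perp)
  have dv': "dv' (s \<circ> \<tau>) = dv s \<circ> \<tau>" if "s \<in> sections M E" for s
    using assms(8) that by (simp add: is_pullback_divergence_def)
  have operator: "pull.ricci_operator (u \<circ> \<tau>) = base.ricci_operator u \<circ> \<tau>" if u: "u \<in> sections M E" for u
  proof -
    have ub: "bracket A u b \<in> sections M E"
      by (rule bracket_section[OF assms(3) u base.b_section])
    show ?thesis
      unfolding pull.ricci_operator_def base.ricci_operator_def perp
        ca_pullback_bracket[OF pb u base.b_section] proj_perp
        ca_pullback_bracket[OF pb base.oproj_perp_section[OF ub] base.a_section] proj ..
  qed
  show ?thesis
  proof
    fix x
    have "fibre_endo M' ?E' ?V' pull.ricci_operator x v = fibre_endo M E Vp base.ricci_operator (\<tau> x) v"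
      if v: "v \<in> Vp (\<tau> x)" for v
    proof -
      obtain u where u: "u \<in> sub_sections M E Vp" "u (\<tau> x) = v"
        using base.sub_section_through[OF v] .
      then have us: "u \<in> sections M E" by (simp add: sub_sections_def)
      have "fibre_endo M' ?E' ?V' pull.ricci_operator x ((u \<circ> \<tau>) x) = pull.ricci_operator (u \<circ> \<tau>) x"
        by (rule pull.fibre_endo_ricci_operator[OF sub_sections[OF u(1)]])
      also have "\<dots> = fibre_endo M E Vp base.ricci_operator (\<tau> x) (u (\<tau> x))"
        by (simp add: operator[OF us] base.fibre_endo_ricci_operator[OF u(1)])
      finally show ?thesis by (simp add: u(2))
    qed
    then have trace: "bundle_trace M' ?E' ?V' pull.ricci_operator x = bundle_trace M E Vp base.ricci_operator (\<tau> x)"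
      unfolding bundle_trace_def comp_def by (rule trace_on_cong[OF base.V_has_basis])
    have ba: "bracket A b a \<in> sections M E"
      by (rule bracket_section[OF assms(3) base.b_section base.a_section])
    have div: "dv' (oproj ?E' A' ?V' (bracket A' (b \<circ> \<tau>) (a \<circ> \<tau>))) x = dv (oproj E A Vp (bracket A b a)) (\<tau> x)"
      by (simp add: ca_pullback_bracket[OF pb base.b_section base.a_section] proj
          dv'[OF base.oproj_section[OF ba]])
    have "dv a \<in> smooth_functions M"
      using assms(5) base.a_section by (simp add: divergence_def)
    then have act: "act A' (b \<circ> \<tau>) (dv' (a \<circ> \<tau>)) x = act A b (dv a) (\<tau> x)"
      using fun_cong[OF ca_pullback_anchor[OF pb base.b_section, of x], of "dv a"]
      by (simp add: act_def dv'[OF base.a_section] pushforward_def)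
    show "GRic M' ?E' A' ?V' dv' (a \<circ> \<tau>) (b \<circ> \<tau>) x = (GRic M E A Vp dv a b \<circ> \<tau>) x"
      using div act trace
      by (simp add: GRic_def pull.ricci_operator_def[abs_def] base.ricci_operator_def[abs_def])
  qed
qed

end
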